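(* Let $0<q<1$. For all non-negative integers $m$ and $n$ and every positive integer $r$, $$\sum_{k_1,\dots,k_r=-n}^n\ \prod_{1\le i<j\le r}[k_j-k_i]_q^2\,[k_i+k_j]_q^2\ \prod_{i=1}^r q^{k_i^2-(2i-1)k_i}\,\big|[k_i]_{q^2}\big|\begin{bmatrix}2n\\ n+k_i\end{bmatrix}_q\begin{bmatrix}2m\\ m+k_i\end{bmatrix}_q$$ $$=r!\Big(\frac{2}{[2]_q}\Big)^r q^{-2\binom{r+1}{3}}\prod_{i=1}^r\Bigg(\frac{\Gamma_q(i)^2\,\Gamma_q(2n+1)}{\Gamma_q(n-i+2)\,\Gamma_q(n-i+1)}\cdot\frac{\Gamma_q(2m+1)}{\Gamma_q(m-i+2)\,\Gamma_q(m-i+1)}\cdot\frac{\Gamma_q(m+n-i-r+2)}{\Gamma_q(m+n-i+2)}\Bigg).$$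
   Context: Notation: $(a;q)_\infty=\prod_{k\ge1}(1-aq^{k-1})$; $(a;q)_k=\prod_{j=1}^k(1-aq^{j-1})$; $\begin{bmatrix}N\\ M\end{bmatrix}_q=\frac{(q;q)_N}{(q;q)_M(q;q)_{N-M}}$ for integers $0\le M\le N$, and $0$ for integers $M<0$ or $M>N$; $[x]_q=\frac{1-q^x}{1-q}$ (and $[x]_{q^2}$ is the same with $q$ replaced by $q^2$); $\Gamma_q(x)=(1-q)^{1-x}\frac{(q;q)_\infty}{(q^x;q)_\infty}$, so $1/\Gamma_q(x)=0$ for $x\in\{0,-1,-2,\dots\}$. If a numerator factor on the right-hand side has a pole, the right-hand side is understood as its limiting value when $m,n$ are replaced by $m+\varepsilon,n+\varepsilon$ and $\varepsilon\to0$. *)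

theory Defs
  imports "HOL-Analysis.Analysis"
begin

definition qpoch :: "real \<Rightarrow> real \<Rightarrow> nat \<Rightarrow> real" where
  "qpoch a q k = (\<Prod>j=1..k. 1 - a * q ^ (j - 1))"

definition qpoch_inf :: "real \<Rightarrow> real \<Rightarrow> real" where
  "qpoch_inf a q = (\<Prod>k. 1 - a * q ^ k)"

definition qnum :: "real \<Rightarrow> real \<Rightarrow> real" where
  "qnum q x = (1 - q powr x) / (1 - q)"

definition qbinom :: "real \<Rightarrow> int \<Rightarrow> int \<Rightarrow> real" where
  "qbinom q N M =
     (if 0 \<le> M \<and> M \<le> N
      then qpoch q q (nat N) / (qpoch q q (nat M) * qpoch q q (nat (N - M)))
      else 0)"

text \<open>
  At the poles \<open>x = 0, -1, -2, \<dots>\<close> the denominator vanishes, so the value below is \<open>0\<close> by the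
  convention \<open>a / 0 = 0\<close>.  Hence a factor \<open>qGamma q x\<close> in a denominator behaves as
  \<open>1 / qGamma q x = 0\<close>, which is the intended value there.  A pole in a numerator has to
  be treated by a limit (see \<open>rhs_numerator_pole\<close>).
\<close>
definition qGamma :: "real \<Rightarrow> real \<Rightarrow> real" where
  "qGamma q x = (1 - q) powr (1 - x) * qpoch_inf q q / qpoch_inf (q powr x) q"

text \<open>
  The index tuple \<open>(k\<^sub>1, \<dots>, k\<^sub>r)\<close> is an extensional function on \<open>{1..r}\<close>.
\<close>
definition lhs_sum :: "real \<Rightarrow> nat \<Rightarrow> nat \<Rightarrow> nat \<Rightarrow> real" where
  "lhs_sum q r m n =
     (\<Sum>k \<in> {1..r} \<rightarrow>\<^sub>E {- int n..int n}.
        (\<Prod>(i, j) \<in> {(i, j). 1 \<le> i \<and> i < j \<and> j \<le> r}.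
            (qnum q (of_int (k j - k i)))\<^sup>2 * (qnum q (of_int (k i + k j)))\<^sup>2) *
        (\<Prod>i=1..r.
            q powi ((k i)\<^sup>2 - (2 * int i - 1) * k i) *
            \<bar>qnum (q\<^sup>2) (of_int (k i))\<bar> *
            qbinom q (2 * int n) (int n + k i) *
            qbinom q (2 * int m) (int m + k i)))"

text \<open>
  \<open>m\<close> and \<open>n\<close> are real here, so that they can be replaced by \<open>m + \<epsilon>\<close> and \<open>n + \<epsilon>\<close>.
\<close>
definition rhs_prod :: "real \<Rightarrow> nat \<Rightarrow> real \<Rightarrow> real \<Rightarrow> real" where
  "rhs_prod q r m n =
     fact r * (2 / qnum q 2) ^ r * q powi (- 2 * int ((r + 1) choose 3)) *
     (\<Prod>i=1..r.
        ((qGamma q (real i))\<^sup>2 * qGamma q (2 * n + 1)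
           / (qGamma q (n - real i + 2) * qGamma q (n - real i + 1))) *
        (qGamma q (2 * m + 1)
           / (qGamma q (m - real i + 2) * qGamma q (m - real i + 1))) *
        (qGamma q (m + n - real i - real r + 2)
           / qGamma q (m + n - real i + 2)))"

text \<open>
  For real arguments, the poles of \<open>qGamma q\<close> are exactly the non-positive integers; the
  set lists the arguments of all numerator factors in \<open>rhs_prod q r m n\<close>.
\<close>
definition rhs_numerator_pole :: "nat \<Rightarrow> real \<Rightarrow> real \<Rightarrow> bool" where
  "rhs_numerator_pole r m n \<longleftrightarrow>
     (\<exists>i\<in>{1..r}.
        {real i, 2 * n + 1, 2 * m + 1, m + n - real i - real r + 2} \<inter> \<int>\<^sub>\<le>\<^sub>0 \<noteq> {})"

end

theory Submission
  imports Defs "Jordan_Normal_Form.Determinant"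
begin

text \<open>
  The weights \<open>q\<^bsup>-(2i-1)k\<^sub>i\<^esup>\<close> break the symmetry of the summand in \<open>k\<^sub>1, \<dots>, k\<^sub>r\<close> only apparently.
  Since \<open>[b - a]\<^sub>q [a + b]\<^sub>q = q\<^bsup>b\<^esup> (x\<^sub>b - x\<^sub>a)\<close> on the quadratic lattice
  \<open>x\<^sub>k = (q\<^bsup>k\<^esup> + q\<^bsup>-k\<^esup>) / (1 - q)\<^sup>2\<close>, the factors \<open>q\<^bsup>2b\<^esup>\<close> released by the squared differences turn the
  sum into \<open>\<Sum> \<Delta>(x)\<^sup>2 \<Prod> w(k\<^sub>i)\<close>, where \<open>\<Delta>\<close> is the Vandermonde product and \<open>w\<close> is one and the same
  even weight for every variable (\<open>lhs_sum_eq_lattice\<close>).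

  By the Andreief identity such a sum is \<open>r!\<close> times an \<open>r \<times> r\<close> determinant of moments
  \<open>\<Sum> w p\<^sub>i s\<^sub>j\<close>, where the two factors \<open>\<Delta>\<close> may be expanded in two different polynomial bases. The right
  choice is the pair of Newton bases
  \<open>p\<^sub>i = \<Prod>\<^bsub>l<i\<^esub> [n - l + k][n - l - k]\<close> and \<open>s\<^sub>j = \<Prod>\<^bsub>l<j\<^esub> [m - l + k][m - l - k]\<close>, which are
  polynomials in \<open>x\<^sub>k\<close>: multiplying by \<open>p\<^sub>i\<close> replaces \<open>n\<close> by \<open>n - i\<close> in the q-binomial coefficient,
  up to a constant, and \<open>s\<^sub>j\<close> acts in the same way on \<open>m\<close>. Every moment is therefore an instance
  of the case \<open>r = 1\<close>, and that sum telescopes (\<open>moment_term_telescopes\<close>). The entry \<open>(i, j)\<close> comes out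
  as a factor depending on \<open>i\<close>, times a factor depending on \<open>j\<close>, times \<open>1 / [m + n - i - j]\<^sub>q\<close>.
  This is a Cauchy determinant (\<open>cauchy_determinant\<close>), and collecting the factors gives the product
  for \<open>r \<le> min m n\<close> (\<open>lhs_sum_eq_rhs_prod\<close>).

  If \<open>r > min m n\<close>, the moment matrix has a zero row or a zero column, so the sum vanishes. The
  product has to vanish as well. If no numerator has a pole this is due to a factor
  \<open>1 / \<Gamma>\<^sub>q(0)\<close>; otherwise the zeros contributed by the reciprocal q-Gamma functions outnumber the poles,
  by a count of orders in \<open>\<epsilon>\<close> (\<open>rhs_prod_tendsto_0\<close>). For \<open>r \<le> min m n\<close> all numerator arguments
  are positive, so that a limit occurs only where both sides are zero.
\<close>

section \<open>Determinants of functions of two indices\<close>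

text \<open>
  A matrix is passed as a function of its two indices, so that its entries can be rewritten
  without going through matrix operations.
\<close>
definition fdet :: "nat \<Rightarrow> (nat \<Rightarrow> nat \<Rightarrow> real) \<Rightarrow> real" where
  "fdet n f = Determinant.det (Matrix.mat n n (\<lambda>(i, j). f i j))"

lemma permutes_lt: "p permutes {0..<n} \<Longrightarrow> i < n \<Longrightarrow> p i < (n::nat)"
  using permutes_in_image[of p "{0..<n}" i] by auto

lemma fdet_cong:
  assumes "\<And>i j. i < n \<Longrightarrow> j < n \<Longrightarrow> f i j = g i j"
  shows "fdet n f = fdet n g"
  unfolding fdet_def by (rule arg_cong[of _ _ Determinant.det], rule eq_matI) (use assms in auto)

lemma fdet_rows:
  "fdet n f = (\<Sum>p | p permutes {0..<n}. signof p * (\<Prod>i = 0..<n. f i (p i)))"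
  unfolding fdet_def by (subst det_def') (auto intro!: sum.cong prod.cong simp: permutes_lt)

lemma fdet_columns:
  "fdet n f = (\<Sum>p | p permutes {0..<n}. signof p * (\<Prod>i = 0..<n. f (p i) i))"
  unfolding fdet_def
  by (subst mat_det_left_def[where n = n]) (auto intro!: sum.cong prod.cong simp: permutes_lt)

lemma fdet_transpose: "fdet n (\<lambda>i j. f j i) = fdet n f"
  by (subst fdet_rows, subst fdet_columns) simp

lemma fdet_permute_rows:
  assumes "p permutes {0..<n}"
  shows "fdet n (\<lambda>i. f (p i)) = signof p * fdet n f"
proof -
  have "Matrix.mat n n (\<lambda>(i, j). f (p i) j) =
        Matrix.mat n n (\<lambda>(i, j). Matrix.mat n n (\<lambda>(i, j). f i j) $$ (p i, j))"
    by (rule eq_matI) (use assms in \<open>auto simp: permutes_lt\<close>)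
  then show ?thesis
    unfolding fdet_def
    using det_permute_rows[of "Matrix.mat n n (\<lambda>(i, j). f i j)" n p] assms by simp
qed

lemma fdet_permute_columns:
  assumes "p permutes {0..<n}"
  shows "fdet n (\<lambda>i j. f i (p j)) = signof p * fdet n f"
proof -
  have "fdet n (\<lambda>i j. f i (p j)) = fdet n (\<lambda>i j. f j (p i))"
    by (rule fdet_transpose)
  also have "\<dots> = signof p * fdet n (\<lambda>i j. f j i)"
    by (rule fdet_permute_rows[OF assms])
  finally show ?thesis unfolding fdet_transpose[of n f] .
qed

lemma fdet_mult:
  "fdet n (\<lambda>i j. \<Sum>l = 0..<n. f i l * g l j) = fdet n f * fdet n g"
proof -
  have "Matrix.mat n n (\<lambda>(i, j). \<Sum>l = 0..<n. f i l * g l j) =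
        Matrix.mat n n (\<lambda>(i, j). f i j) * Matrix.mat n n (\<lambda>(i, j). g i j)"
    by (rule eq_matI) (auto simp: scalar_prod_def)
  then show ?thesis
    unfolding fdet_def
    using det_mult[of "Matrix.mat n n (\<lambda>(i, j). f i j)" n "Matrix.mat n n (\<lambda>(i, j). g i j)"] by simp
qed

lemma fdet_scale:
  "fdet n (\<lambda>i j. a i * b j * f i j) = (\<Prod>i = 0..<n. a i) * (\<Prod>j = 0..<n. b j) * fdet n f"
proof -
  have "(\<Prod>i = 0..<n. b (p i)) = (\<Prod>j = 0..<n. b j)" if "p permutes {0..<n}" for p
    using prod.permute[OF that, of b] by (simp add: o_def)
  then show ?thesis
    unfolding fdet_rows sum_distrib_left
    by (intro sum.cong) (auto simp: prod.distrib)
qed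

lemma fdet_zero_row:
  assumes "i < n" "\<And>j. j < n \<Longrightarrow> f i j = 0"
  shows "fdet n f = 0"
  unfolding fdet_rows
proof (rule sum.neutral, safe)
  fix p assume "p permutes {0..<n}"
  then have "f i (p i) = 0" using assms by (auto simp: permutes_lt)
  then show "signof p * (\<Prod>i = 0..<n. f i (p i)) = 0" using assms by (auto intro!: bexI[of _ i])
qed

lemma fdet_lower_triangular:
  assumes "\<And>i j. i < j \<Longrightarrow> j < n \<Longrightarrow> f i j = 0"
  shows "fdet n f = (\<Prod>i = 0..<n. f i i)"
  unfolding fdet_def
  by (subst det_lower_triangular[where n = n])
     (use assms in \<open>auto simp: prod_list_diag_prod intro!: prod.cong\<close>)

lemma fdet_upper_triangular:
  assumes "\<And>i j. j < i \<Longrightarrow> i < n \<Longrightarrow> f i j = 0"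
  shows "fdet n f = (\<Prod>i = 0..<n. f i i)"
  using fdet_lower_triangular[of n "\<lambda>i j. f j i"] assms unfolding fdet_transpose[of n f] by simp

section \<open>The Andreief identity\<close>

text \<open>
  Expanding the second determinant into permutations \<open>p\<close> and renaming the summation variables
  along \<open>p\<close> changes the first determinant by the sign of \<open>p\<close>, which cancels the sign in the expansion.
  All \<open>n!\<close> terms are thus equal to the one for the identity, in which every column of the first
  determinant can be summed over its own variable.
\<close>
theorem andreief_identity:
  assumes "finite K"
  shows "(\<Sum>k \<in> {0..<n} \<rightarrow>\<^sub>E K. fdet n (\<lambda>i j. a i (k j)) * fdet n (\<lambda>i j. b i (k j))) =
         fact n * fdet n (\<lambda>i j. \<Sum>x\<in>K. a i x * b j x)"
proof -
  let ?P = "{p. p permutes {0..<n}}" and ?T = "{0..<n} \<rightarrow>\<^sub>E K"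
  define D where "D k = fdet n (\<lambda>i j. a i (k j))" for k
  have D_perm: "D (k \<circ> p) = signof p * D k" if "p permutes {0..<n}" for k p
    using fdet_permute_columns[OF that, of "\<lambda>i j. a i (k j)"] by (simp add: D_def)
  \<comment> \<open>the contribution of the identity permutation\<close>
  define S where "S = (\<Sum>k\<in>?T. D k * (\<Prod>j = 0..<n. b j (k j)))"
  have perm: "signof p * (\<Sum>k\<in>?T. D k * (\<Prod>j = 0..<n. b (p j) (k j))) = S"
    if p: "p permutes {0..<n}" for p
  proof -
    have inv: "inv_into UNIV p permutes {0..<n}" using p by (rule permutes_inv)
    have "(\<Sum>k\<in>?T. D k * (\<Prod>j = 0..<n. b (p j) (k j))) =
          (\<Sum>k\<in>?T. D (k \<circ> p) * (\<Prod>j = 0..<n. b (p j) (k (p j))))"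
    proof (rule sum.reindex_bij_witness[of _ "\<lambda>k. k \<circ> p" "\<lambda>k. k \<circ> inv_into UNIV p"])
      fix k assume k: "k \<in> ?T"
      show "(k \<circ> inv_into UNIV p) \<circ> p = k" "(k \<circ> p) \<circ> inv_into UNIV p = k"
        by (auto simp: fun_eq_iff permutes_inverses[OF p])
      have "k \<circ> t \<in> ?T" if t: "t permutes {0..<n}" for t
      proof (rule PiE_I)
        fix i assume "i \<in> {0..<n}"
        then show "(k \<circ> t) i \<in> K" using k permutes_lt[OF t, of i] by (auto simp: PiE_iff)
      next
        fix i assume "i \<notin> {0..<n}"
        then show "(k \<circ> t) i = undefined"
          using k permutes_not_in[OF t, of i] by (auto simp: PiE_iff extensional_def)
      qed
      then show "k \<circ> inv_into UNIV p \<in> ?T" "k \<circ> p \<in> ?T" using p inv by auto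
      have "k \<circ> inv_into UNIV p \<circ> p = k" by (auto simp: fun_eq_iff permutes_inverses[OF p])
      moreover have "(k \<circ> inv_into UNIV p) (p j) = k j" for j by (auto simp: permutes_inverses[OF p])
      ultimately show "D (k \<circ> inv_into UNIV p \<circ> p) * (\<Prod>j = 0..<n. b (p j) ((k \<circ> inv_into UNIV p) (p j))) =
            D k * (\<Prod>j = 0..<n. b (p j) (k j))" by simp
    qed
    also have "\<dots> = (\<Sum>k\<in>?T. signof p * (D k * (\<Prod>j = 0..<n. b j (k j))))"
    proof (rule sum.cong[OF refl])
      fix k
      have "(\<Prod>j = 0..<n. b (p j) (k (p j))) = (\<Prod>j = 0..<n. b j (k j))"
        using prod.permute[OF p, of "\<lambda>j. b j (k j)"] by (simp add: o_def)
      then show "D (k \<circ> p) * (\<Prod>j = 0..<n. b (p j) (k (p j))) =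
                 signof p * (D k * (\<Prod>j = 0..<n. b j (k j)))"
        by (simp add: D_perm[OF p])
    qed
    also have "\<dots> = signof p * S" by (simp add: S_def sum_distrib_left)
    finally show ?thesis by (simp add: sign_def)
  qed
  have "(\<Sum>k\<in>?T. D k * fdet n (\<lambda>i j. b i (k j))) =
        (\<Sum>k\<in>?T. \<Sum>p\<in>?P. signof p * (D k * (\<Prod>j = 0..<n. b (p j) (k j))))"
    by (simp add: fdet_columns sum_distrib_left mult_ac)
  also have "\<dots> = (\<Sum>p\<in>?P. signof p * (\<Sum>k\<in>?T. D k * (\<Prod>j = 0..<n. b (p j) (k j))))"
    by (subst sum.swap) (simp add: sum_distrib_left)
  also have "\<dots> = (\<Sum>p\<in>?P. S)" by (rule sum.cong) (use perm in auto)
  also have "\<dots> = fact n * S" by (simp add: card_permutations[of _ n])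
  also have "S = (\<Sum>k\<in>?T. \<Sum>p\<in>?P. signof p * (\<Prod>j = 0..<n. a (p j) (k j) * b j (k j)))"
    by (simp add: S_def D_def fdet_columns sum_distrib_left sum_distrib_right prod.distrib mult_ac)
  also have "\<dots> = (\<Sum>p\<in>?P. signof p * (\<Sum>k\<in>?T. \<Prod>j = 0..<n. a (p j) (k j) * b j (k j)))"
    by (subst sum.swap) (simp add: sum_distrib_left)
  also have "\<dots> = (\<Sum>p\<in>?P. signof p * (\<Prod>j = 0..<n. \<Sum>x\<in>K. a (p j) x * b j x))"
    using assms by (simp add: prod_sum_PiE)
  finally show ?thesis by (simp add: D_def fdet_columns)
qed

section \<open>Vandermonde and Cauchy determinants\<close>

text \<open>The matrix of values is the coefficient matrix times the Vandermonde matrix.\<close>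
lemma fdet_poly_eq_monomials:
  assumes "\<And>i. i < n \<Longrightarrow> degree (p i) < n"
  shows "fdet n (\<lambda>i j. poly (p i) (x j)) =
         fdet n (\<lambda>i l. coeff (p i) l) * fdet n (\<lambda>l j. x j ^ l)"
proof -
  have "poly (p i) y = (\<Sum>l = 0..<n. coeff (p i) l * y ^ l)" if "i < n" for i y
    unfolding poly_altdef
    by (rule sum.mono_neutral_left) (use assms[OF that] in \<open>auto simp: coeff_eq_0\<close>)
  then show ?thesis unfolding fdet_mult[symmetric] by (intro fdet_cong) auto
qed

text \<open>
  Consequently, polynomials of strictly increasing degree see the points only through the
  Vandermonde product; the rest is the product of the leading coefficients.
\<close>
lemma fdet_poly_triangular:
  assumes "\<And>i. i < n \<Longrightarrow> degree (p i) \<le> i"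
  shows "fdet n (\<lambda>i j. poly (p i) (x j)) = (\<Prod>i = 0..<n. coeff (p i) i) * fdet n (\<lambda>l j. x j ^ l)"
proof -
  have "degree (p i) < n" if "i < n" for i using assms[OF that] that by simp
  moreover have "fdet n (\<lambda>i l. coeff (p i) l) = (\<Prod>i = 0..<n. coeff (p i) i)"
  proof (rule fdet_lower_triangular)
    fix i j :: nat assume "i < j" "j < n"
    then show "coeff (p i) j = 0" using assms[of i] by (intro coeff_eq_0) simp
  qed
  ultimately show ?thesis using fdet_poly_eq_monomials[of n p x] by simp
qed

lemma degree_prod_linear: "degree (\<Prod>l = 0..<i. [:c l, d l:]) \<le> (i::nat)" for c d :: "nat \<Rightarrow> real"
proof (induction i)
  case (Suc i)
  have "degree ((\<Prod>l = 0..<i. [:c l, d l:]) * [:c i, d i:]) \<le> i + 1"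
    by (rule order.trans[OF degree_mult_le]) (use Suc in \<open>auto intro!: add_mono\<close>)
  then show ?case by simp
qed simp

lemma coeff_prod_linear: "coeff (\<Prod>l = 0..<i. [:c l, d l:]) i = (\<Prod>l = 0..<i. d l)" for c d :: "nat \<Rightarrow> real"
proof (induction i)
  case (Suc i)
  have "coeff ((\<Prod>l = 0..<i. [:c l, d l:]) * [:c i, d i:]) (Suc i) = (\<Prod>l = 0..<i. d l) * d i"
    using Suc coeff_eq_0[OF le_imp_less_Suc[OF degree_prod_linear[of c d i]]] by (simp add: mult.commute)
  then show ?case by simp
qed simp

text \<open>
  With \<open>p\<^sub>i\<close> the monic polynomial vanishing at \<open>x\<^sub>0, \<dots>, x\<^bsub>i-1\<^esub>\<close>, the matrix \<open>p\<^sub>i(x\<^sub>j)\<close> has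
  the same determinant and is triangular.
\<close>
theorem vandermonde_determinant:
  "fdet n (\<lambda>l j. x j ^ l) = (\<Prod>j = 0..<n. \<Prod>i = 0..<j. x j - x i)"
proof -
  define p where "p i = (\<Prod>l = 0..<i. [:- x l, 1:])" for i
  have "fdet n (\<lambda>i j. poly (p i) (x j)) = fdet n (\<lambda>l j. x j ^ l)"
    by (subst fdet_poly_triangular) (auto simp: p_def degree_prod_linear coeff_prod_linear)
  moreover have "fdet n (\<lambda>i j. poly (p i) (x j)) = (\<Prod>j = 0..<n. poly (p j) (x j))"
    by (rule fdet_upper_triangular) (auto simp: p_def poly_prod)
  ultimately show ?thesis by (simp add: p_def poly_prod)
qed

text \<open>
  The form in which the Vandermonde product is expanded: any choice of linear factors may be
  used, at the price of the leading coefficients.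
\<close>
lemma fdet_newton:
  "fdet n (\<lambda>i j. \<Prod>l = 0..<i. c l + d l * x j) =
   (\<Prod>i = 0..<n. \<Prod>l = 0..<i. d l) * (\<Prod>j = 0..<n. \<Prod>i = 0..<j. x j - x i)"
  using fdet_poly_triangular[of n "\<lambda>i. \<Prod>l = 0..<i. [:c l, d l:]" x]
  by (simp add: degree_prod_linear coeff_prod_linear vandermonde_determinant poly_prod mult.commute)

lemma prod_distinct_pairs:
  fixes g :: "nat \<Rightarrow> nat \<Rightarrow> 'a :: comm_monoid_mult"
  shows "(\<Prod>i = 0..<n. \<Prod>l \<in> {0..<n} - {i}. g i l) = (\<Prod>j = 0..<n. \<Prod>i = 0..<j. g j i * g i j)"
proof (induction n)
  case (Suc n)
  have "(\<Prod>i = 0..<Suc n. \<Prod>l \<in> {0..<Suc n} - {i}. g i l) =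
        (\<Prod>i = 0..<n. \<Prod>l \<in> {0..<Suc n} - {i}. g i l) * (\<Prod>l = 0..<n. g n l)"
  proof -
    have "{0..<Suc n} - {n} = {0..<n}" by auto
    then show ?thesis by simp
  qed
  also have "(\<Prod>i = 0..<n. \<Prod>l \<in> {0..<Suc n} - {i}. g i l) =
             (\<Prod>i = 0..<n. g i n * (\<Prod>l \<in> {0..<n} - {i}. g i l))"
  proof (rule prod.cong[OF refl])
    fix i assume "i \<in> {0..<n}"
    then have "{0..<Suc n} - {i} = insert n ({0..<n} - {i})" by auto
    then show "(\<Prod>l \<in> {0..<Suc n} - {i}. g i l) = g i n * (\<Prod>l \<in> {0..<n} - {i}. g i l)" by simp
  qed
  finally show ?case using Suc by (simp add: prod.distrib mult_ac)
qed simp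

text \<open>
  Clearing the denominators in the variable \<open>x\<close> leaves values at \<open>x\<^sub>j\<close> of the polynomials
  \<open>G\<^sub>i(t) = \<Prod>\<^bsub>l\<noteq>i\<^esub> (1 - y\<^sub>l t)\<close> of degree below \<open>n\<close>. Their determinant is a constant \<open>C\<close>, independent of
  the points, times the Vandermonde product of the points. At the points \<open>1 / y\<^sub>j\<close> the matrix is
  diagonal, and comparison of the two evaluations there shows that \<open>C\<close> is the Vandermonde product of the \<open>y\<^sub>j\<close>.
\<close>
theorem cauchy_determinant:
  assumes ne: "\<And>i j. i < n \<Longrightarrow> j < n \<Longrightarrow> x i * y j \<noteq> 1"
    and y0: "\<And>j. j < n \<Longrightarrow> y j \<noteq> 0"
    and inj: "\<And>i j. i < j \<Longrightarrow> j < n \<Longrightarrow> y i \<noteq> y j"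
  shows "fdet n (\<lambda>i j. 1 / (1 - x i * y j)) =
         (\<Prod>j = 0..<n. \<Prod>i = 0..<j. (x j - x i) * (y j - y i)) /
         (\<Prod>i = 0..<n. \<Prod>j = 0..<n. 1 - x i * y j)"
proof -
  define G where "G j = (\<Prod>l \<in> {0..<n} - {j}. [:1, - y l:])" for j
  have deg: "degree (G j) < n" if "j < n" for j
  proof -
    have "degree (G j) \<le> (\<Sum>l \<in> {0..<n} - {j}. degree [:1, - y l:])"
      unfolding G_def by (rule order.trans[OF degree_prod_sum_le]) simp_all
    also have "\<dots> \<le> (\<Sum>l \<in> {0..<n} - {j}. 1)" by (rule sum_mono) simp
    also have "\<dots> < n" using that by simp
    finally show ?thesis .
  qed
  define C where "C = fdet n (\<lambda>i l. coeff (G i) l)"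
  have G_det: "fdet n (\<lambda>i j. poly (G i) (z j)) = C * (\<Prod>j = 0..<n. \<Prod>i = 0..<j. z j - z i)" for z
    unfolding C_def using fdet_poly_eq_monomials[of n G z] deg by (simp add: vandermonde_determinant)
  have poly_G: "poly (G i) t = (\<Prod>l \<in> {0..<n} - {i}. 1 - y l * t)" for i t
    by (simp add: G_def poly_prod mult.commute)
  have "fdet n (\<lambda>i j. poly (G i) (1 / y j)) = (\<Prod>i = 0..<n. poly (G i) (1 / y i))"
  proof (rule fdet_lower_triangular)
    fix i j :: nat assume "i < j" "j < n"
    then show "poly (G i) (1 / y j) = 0" using y0[of j] by (auto simp: poly_G intro!: bexI[of _ j])
  qed
  also have "\<dots> = (\<Prod>j = 0..<n. \<Prod>i = 0..<j. (1 - y i / y j) * (1 - y j / y i))"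
    unfolding poly_G using prod_distinct_pairs[of "\<lambda>i l. 1 - y l / y i" n] by simp
  also have "\<dots> = (\<Prod>j = 0..<n. \<Prod>i = 0..<j. (y j - y i) * (1 / y j - 1 / y i))"
  proof (intro prod.cong refl)
    fix j i assume "j \<in> {0..<n}" "i \<in> {0..<j}"
    then show "(1 - y i / y j) * (1 - y j / y i) = (y j - y i) * (1 / y j - 1 / y i)"
      using y0[of i] y0[of j] by (simp add: field_simps)
  qed
  also have "\<dots> = (\<Prod>j = 0..<n. \<Prod>i = 0..<j. y j - y i) * (\<Prod>j = 0..<n. \<Prod>i = 0..<j. 1 / y j - 1 / y i)"
    by (simp add: prod.distrib)
  finally have "C * (\<Prod>j = 0..<n. \<Prod>i = 0..<j. 1 / y j - 1 / y i) = \<dots>"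
    by (simp add: G_det)
  moreover have "(\<Prod>j = 0..<n. \<Prod>i = 0..<j. 1 / y j - 1 / y i) \<noteq> 0"
  proof -
    have "1 / y j - 1 / y i \<noteq> 0" if "i < j" "j < n" for i j
      using inj[OF that] y0[of i] y0[of j] that by (simp add: field_simps)
    then show ?thesis by simp
  qed
  ultimately have C: "C = (\<Prod>j = 0..<n. \<Prod>i = 0..<j. y j - y i)" by simp
  have "fdet n (\<lambda>i j. poly (G i) (x j)) =
        fdet n (\<lambda>i j. 1 * (\<Prod>l = 0..<n. 1 - x j * y l) * (1 / (1 - x j * y i)))"
  proof (rule fdet_cong)
    fix i j assume ij: "i < n" "j < n"
    have "(\<Prod>l = 0..<n. 1 - x j * y l) = (1 - x j * y i) * (\<Prod>l \<in> {0..<n} - {i}. 1 - x j * y l)"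
      using ij by (intro prod.remove) auto
    then show "poly (G i) (x j) = 1 * (\<Prod>l = 0..<n. 1 - x j * y l) * (1 / (1 - x j * y i))"
      using ne[OF ij(2,1)] by (simp add: poly_G mult.commute)
  qed
  also have "\<dots> = (\<Prod>i = 0..<n. \<Prod>j = 0..<n. 1 - x i * y j) * fdet n (\<lambda>i j. 1 / (1 - x i * y j))"
    by (subst fdet_scale, subst fdet_transpose[of n "\<lambda>i j. 1 / (1 - x i * y j)", symmetric]) simp
  finally have "(\<Prod>i = 0..<n. \<Prod>j = 0..<n. 1 - x i * y j) * fdet n (\<lambda>i j. 1 / (1 - x i * y j)) =
                (\<Prod>j = 0..<n. \<Prod>i = 0..<j. (x j - x i) * (y j - y i))"
    by (simp add: G_det C prod.distrib mult.commute)
  moreover have "(\<Prod>i = 0..<n. \<Prod>j = 0..<n. 1 - x i * y j) \<noteq> 0"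
    using ne by (auto simp: prod_zero_iff)
  ultimately show ?thesis by (simp add: field_simps)
qed

section \<open>q-integers and q-factorials\<close>

definition qint :: "real \<Rightarrow> int \<Rightarrow> real" where
  "qint q z = (1 - q powi z) / (1 - q)"

definition qfact :: "real \<Rightarrow> nat \<Rightarrow> real" where
  "qfact q n = (\<Prod>j = 0..<n. qint q (int (Suc j)))"

text \<open>
  The reciprocal \<open>1 / [z]!\<close>, continued by 0 to negative integers. With this convention
  \<open>[z] / [z]! = 1 / [z - 1]!\<close> holds for all integers, so that q-binomial coefficients outside their support
  need no case distinctions.
\<close>
definition rqfact :: "real \<Rightarrow> int \<Rightarrow> real" where
  "rqfact q z = (if z < 0 then 0 else 1 / qfact q (nat z))"

text \<open>
  The points on which the sum is a discrete orthogonal ensemble. The normalisation by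
  \<open>(1 - q)\<^sup>2\<close> makes differences of points products of two q-integers.
\<close>
definition qlattice :: "real \<Rightarrow> int \<Rightarrow> real" where
  "qlattice q k = (q powi k + q powi (- k)) / (1 - q)\<^sup>2"

text \<open>
  The weight in one variable that remains after the squared differences have absorbed
  the factors \<open>q\<^bsup>-2(i-1)k\<^sub>i\<^esup>\<close>.
\<close>
definition weight :: "real \<Rightarrow> nat \<Rightarrow> nat \<Rightarrow> int \<Rightarrow> real" where
  "weight q m n k = q powi (k\<^sup>2 - k) * \<bar>qnum (q\<^sup>2) (of_int k)\<bar> *
     qbinom q (2 * int n) (int n + k) * qbinom q (2 * int m) (int m + k)"

text \<open>
  The Newton polynomial of degree \<open>i\<close> in the lattice variable whose zeros are the lattice
  points with index \<open>N, N - 1, \<dots>, N - i + 1\<close>, with the leading coefficient that makes its values products of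
  q-integers (see \<open>newton_factor\<close>).
\<close>
definition newton :: "real \<Rightarrow> nat \<Rightarrow> nat \<Rightarrow> int \<Rightarrow> real" where
  "newton q N i k = (\<Prod>l = 0..<i. (1 + q powi (2 * (int N - int l))) / (1 - q)\<^sup>2
                              + - (q powi (int N - int l)) * qlattice q k)"

text \<open>
  For positive \<open>k\<close> and apart from constants, the summand for \<open>r = 1\<close>, with \<open>n\<close> and \<open>m\<close> replaced by
  arbitrary integers \<open>a\<close> and \<open>b\<close>.
\<close>
definition moment_term :: "real \<Rightarrow> int \<Rightarrow> int \<Rightarrow> int \<Rightarrow> real" where
  "moment_term q a b k = q powi (k\<^sup>2 - k) * qint q (2 * k) *
     (rqfact q (a + k) * rqfact q (a - k)) * (rqfact q (b + k) * rqfact q (b - k))"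

locale unit_interval_base =
  fixes q :: real
  assumes q0: "0 < q" and q1: "q < 1"
begin

lemma powi_add: "q powi (a + b) = q powi a * q powi b"
  using q0 by (simp add: power_int_add)

lemma qint_0 [simp]: "qint q 0 = 0"
  by (simp add: qint_def)

lemma qint_pos: "z > 0 \<Longrightarrow> qint q z > 0"
  using q0 q1 by (simp add: qint_def power_int_def power_less_one_iff)

lemma qint_neg: "qint q (- z) = - (q powi (- z)) * qint q z"
  using q0 q1 by (simp add: qint_def power_int_minus field_simps)

lemma qfact_pos: "qfact q n > 0"
  unfolding qfact_def by (rule prod_pos) (simp add: qint_pos)

lemma qfact_Suc: "qfact q (Suc n) = qint q (int (Suc n)) * qfact q n"
  by (simp add: qfact_def)

lemma rqfact_pred: "qint q z * rqfact q z = rqfact q (z - 1)"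
proof (cases "z > 0")
  case True
  then obtain j where j: "z = int (Suc j)" by (metis Suc_pred' zero_less_imp_eq_int)
  then show ?thesis using qint_pos[of z] by (simp add: rqfact_def nat_add_distrib qfact_Suc)
qed (cases "z = 0", auto simp: rqfact_def)

lemma qnum_of_int: "qnum q (of_int z) = qint q z"
  using q0 by (simp add: qnum_def qint_def powr_real_of_int')

lemma qnum_square_of_int: "qnum (q\<^sup>2) (of_int z) = qint q (2 * z) / qint q 2"
proof -
  have "(q\<^sup>2) powr of_int z = q powi (2 * z)"
    using q0 by (simp add: powr_real_of_int' power_int_mult)
  then show ?thesis using q1 by (simp add: qnum_def qint_def)
qed

lemma qpoch_eq_qfact: "qpoch q q k = (1 - q) ^ k * qfact q k"
proof -
  have "qpoch q q k = (\<Prod>j = 0..<k. 1 - q * q ^ j)"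
    unfolding qpoch_def by (rule prod.reindex_bij_witness[of _ Suc "\<lambda>j. j - 1"]) auto
  also have "\<dots> = (\<Prod>j = 0..<k. (1 - q) * qint q (int (Suc j)))"
    using q1 by (intro prod.cong) (auto simp: qint_def power_int_def nat_add_distrib)
  finally show ?thesis by (simp add: prod.distrib qfact_def)
qed

lemma qbinom_eq_rqfact:
  "qbinom q (2 * int n) (int n + k) = qfact q (2 * n) * rqfact q (int n + k) * rqfact q (int n - k)"
proof (cases "- int n \<le> k \<and> k \<le> int n")
  case True
  define a b where "a = nat (int n + k)" and "b = nat (int n - k)"
  have ab: "2 * n = a + b" "nat (2 * int n) = a + b" using True by (auto simp: a_def b_def)
  have "2 * int n - (int n + k) = int n - k" by simp
  then show ?thesis using True q1
    unfolding qbinom_def rqfact_def qpoch_eq_qfact a_def[symmetric] b_def[symmetric]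
    by (simp add: ab b_def[symmetric] power_add)
qed (auto simp: qbinom_def rqfact_def)

end

section \<open>The lattice and its Newton polynomials\<close>

context unit_interval_base
begin

text \<open>
  With \<open>u = q\<^bsup>a\<^esup>\<close> and \<open>v = q\<^bsup>b\<^esup>\<close> this is the square of
  \<open>(1 - v/u)(1 - uv) = v ((v + 1/v) - (u + 1/u))\<close>.
\<close>
lemma lattice_diff:
  "(qint q (b - a))\<^sup>2 * (qint q (a + b))\<^sup>2 = q powi (2 * b) * (qlattice q b - qlattice q a)\<^sup>2"
proof -
  define u v where "u = q powi a" and "v = q powi b"
  have uv: "u \<noteq> 0" "v \<noteq> 0" using q0 by (auto simp: u_def v_def)
  have "qint q (b - a) * qint q (a + b) = (1 - v / u) * (1 - u * v) / (1 - q)\<^sup>2"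
    using q0 by (simp add: qint_def u_def v_def power_int_add power_int_diff power2_eq_square)
  also have "(1 - v / u) * (1 - u * v) = v * ((v + 1 / v) - (u + 1 / u))"
    using uv by (simp add: field_simps)
  also have "\<dots> / (1 - q)\<^sup>2 = v * (qlattice q b - qlattice q a)"
    by (simp add: qlattice_def u_def v_def power_int_minus divide_inverse left_diff_distrib)
  finally have "qint q (b - a) * qint q (a + b) = v * (qlattice q b - qlattice q a)" .
  moreover have "q powi (2 * b) = v\<^sup>2"
    by (simp add: v_def power_int_mult mult.commute[of 2])
  ultimately show ?thesis by (metis power_mult_distrib)
qed

lemma newton_factor:
  "(1 + q powi (2 * a)) / (1 - q)\<^sup>2 + - (q powi a) * qlattice q k = qint q (a + k) * qint q (a - k)"
proof -
  define u v where "u = q powi a" and "v = q powi k"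
  have uv: "u \<noteq> 0" "v \<noteq> 0" using q0 by (auto simp: u_def v_def)
  have "q powi (2 * a) = u * u"
    using powi_add[of a a] by (simp add: u_def)
  then have "(1 + q powi (2 * a)) / (1 - q)\<^sup>2 + - (q powi a) * qlattice q k =
             ((1 + u * u) - u * (v + 1 / v)) / (1 - q)\<^sup>2"
    by (simp add: qlattice_def u_def v_def power_int_minus divide_inverse left_diff_distrib)
  also have "(1 + u * u) - u * (v + 1 / v) = (1 - u * v) * (1 - u / v)"
    using uv by (simp add: field_simps)
  also have "\<dots> / (1 - q)\<^sup>2 = qint q (a + k) * qint q (a - k)"
    using q0 by (simp add: qint_def u_def v_def power_int_add power_int_diff power2_eq_square)
  finally show ?thesis .
qed

text \<open>
  Each of the \<open>i\<close> factors lowers the arguments of both reciprocal q-factorials by one. This is why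
  the Newton basis with zeros at the end points of the support is the right one.
\<close>
lemma newton_rqfact:
  "newton q N i k * (rqfact q (int N + k) * rqfact q (int N - k)) =
   rqfact q (int N - int i + k) * rqfact q (int N - int i - k)"
proof (induction i)
  case (Suc i)
  define a where "a = int N - int i"
  have "newton q N (Suc i) k = newton q N i k * (qint q (a + k) * qint q (a - k))"
    unfolding newton_def a_def by (simp only: prod.atLeast0_lessThan_Suc newton_factor)
  then have "newton q N (Suc i) k * (rqfact q (int N + k) * rqfact q (int N - k)) =
             (newton q N i k * (rqfact q (int N + k) * rqfact q (int N - k))) *
             (qint q (a + k) * qint q (a - k))"
    by simp
  also have "\<dots> = (qint q (a + k) * rqfact q (a + k)) * (qint q (a - k) * rqfact q (a - k))"
    unfolding Suc.IH a_def[symmetric] by simp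
  also have "\<dots> = rqfact q (int N - int (Suc i) + k) * rqfact q (int N - int (Suc i) - k)"
    unfolding rqfact_pred by (simp add: a_def algebra_simps)
  finally show ?case .
qed (simp add: newton_def)

end

section \<open>The moments\<close>

lemma sum_even:
  fixes g :: "int \<Rightarrow> real"
  assumes "\<And>k. g (- k) = g k" "g 0 = 0"
  shows "(\<Sum>k = - int N..int N. g k) = 2 * (\<Sum>k = 1..N. g (int k))"
proof (induction N)
  case (Suc N)
  have "{- int (Suc N)..int (Suc N)} = insert (- int (Suc N)) (insert (int (Suc N)) {- int N..int N})"
    by auto
  then show ?case using Suc assms(1)[of "int (Suc N)"] by simp
qed (use assms in simp)

context unit_interval_base
begin

text \<open>
  The sign comes from the absolute value in the weight. It makes the summand even, because
  \<open>moment_term\<close> is odd in \<open>k\<close>.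
\<close>
lemma weight_newton:
  "weight q m n k * newton q n i k * newton q m j k =
   qfact q (2 * n) * qfact q (2 * m) / qint q 2 * (sgn (of_int k) * moment_term q (int n - int i) (int m - int j) k)"
proof -
  have "\<bar>qnum (q\<^sup>2) (of_int k)\<bar> = sgn (of_int k) * qint q (2 * k) / qint q 2"
  proof -
    consider "k > 0" | "k = 0" | "k < 0" by linarith
    then show ?thesis
    proof cases
      case 3
      then have "qint q (2 * k) < 0"
        using qint_neg[of "2 * - k"] qint_pos[of "2 * - k"] q0 by (simp add: mult_pos_pos)
      then show ?thesis using 3 qint_pos[of 2] by (simp add: qnum_square_of_int abs_divide)
    next
      case 2
      then show ?thesis using qnum_square_of_int[of 0] by simp
    qed (use qint_pos[of 2] qint_pos[of "2 * k"] in \<open>simp add: qnum_square_of_int abs_divide\<close>)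
  qed
  then have "weight q m n k * newton q n i k * newton q m j k =
     q powi (k\<^sup>2 - k) * (sgn (of_int k) * qint q (2 * k) / qint q 2) * qfact q (2 * n) * qfact q (2 * m) *
     (newton q n i k * (rqfact q (int n + k) * rqfact q (int n - k))) *
     (newton q m j k * (rqfact q (int m + k) * rqfact q (int m - k)))"
    unfolding weight_def qbinom_eq_rqfact by simp
  then show ?thesis unfolding newton_rqfact by (simp add: moment_term_def)
qed

lemma moment_term_neg: "moment_term q a b (- k) = - moment_term q a b k"
proof -
  have "k\<^sup>2 + k = (k\<^sup>2 - k) + 2 * k" by simp
  then have "q powi (k\<^sup>2 + k) * q powi (- (2 * k)) = q powi (k\<^sup>2 - k)"
    by (simp add: powi_add[symmetric])
  then show ?thesis
    using qint_neg[of "2 * k"] by (simp add: moment_term_def mult_ac)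
qed

lemma moment_eq_sum:
  "(\<Sum>k = - int n..int n. weight q m n k * newton q n i k * newton q m j k) =
   2 / qint q 2 * qfact q (2 * n) * qfact q (2 * m) *
     (\<Sum>k = 1..n. moment_term q (int n - int i) (int m - int j) (int k))"
proof -
  have "(\<Sum>k = - int n..int n. weight q m n k * newton q n i k * newton q m j k) =
        2 * (\<Sum>k = 1..n. weight q m n (int k) * newton q n i (int k) * newton q m j (int k))"
    unfolding weight_newton by (rule sum_even) (simp_all add: moment_term_neg sgn_minus)
  also have "(\<Sum>k = 1..n. weight q m n (int k) * newton q n i (int k) * newton q m j (int k)) =
     (\<Sum>k = 1..n. qfact q (2 * n) * qfact q (2 * m) / qint q 2 *
        moment_term q (int n - int i) (int m - int j) (int k))"
    unfolding weight_newton by (intro sum.cong) auto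
  also have "\<dots> = qfact q (2 * n) * qfact q (2 * m) / qint q 2 *
        (\<Sum>k = 1..n. moment_term q (int n - int i) (int m - int j) (int k))"
    by (simp only: sum_distrib_left)
  finally show ?thesis by simp
qed

text \<open>
  After removal of the common factor \<open>R\<close>, the claim is the identity
  \<open>[a + k][b + k] - q\<^bsup>2k\<^esup> [a - k][b - k] = [2k][a + b]\<close>.
\<close>
lemma moment_term_telescopes:
  defines "T a b k \<equiv> q powi (k\<^sup>2 - k) * (rqfact q (a + k - 1) * rqfact q (a - k)) *
                      (rqfact q (b + k - 1) * rqfact q (b - k))"
  shows "qint q (a + b) * moment_term q a b k = T a b k - T a b (k + 1)"
proof -
  define R where "R = rqfact q (a + k) * rqfact q (a - k) * rqfact q (b + k) * rqfact q (b - k)"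
  have 1: "T a b k = q powi (k\<^sup>2 - k) * (qint q (a + k) * qint q (b + k)) * R"
    unfolding T_def R_def
    by (simp only: rqfact_pred[of "a + k", symmetric] rqfact_pred[of "b + k", symmetric] mult_ac)
  have "(k + 1)\<^sup>2 - (k + 1) = (k\<^sup>2 - k) + 2 * k" by (simp add: power2_eq_square algebra_simps)
  moreover have "a - (k + 1) = a - k - 1" "b - (k + 1) = b - k - 1" "a + (k + 1) - 1 = a + k"
    "b + (k + 1) - 1 = b + k" by simp_all
  ultimately have 2: "T a b (k + 1) = q powi (k\<^sup>2 - k) * (q powi (2 * k) * (qint q (a - k) * qint q (b - k))) * R"
    unfolding T_def R_def
    by (simp only: rqfact_pred[of "a - k", symmetric] rqfact_pred[of "b - k", symmetric] powi_add mult_ac)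
  have 3: "qint q (a + k) * qint q (b + k) - q powi (2 * k) * (qint q (a - k) * qint q (b - k)) =
        qint q (2 * k) * qint q (a + b)"
  proof -
    have "q powi (2 * k) = q powi k * q powi k" using powi_add[of k k] by simp
    then show ?thesis
      using q0 q1 by (simp add: qint_def power_int_add power_int_diff divide_simps) (simp add: algebra_simps)
  qed
  have "T a b k - T a b (k + 1) = q powi (k\<^sup>2 - k) *
     (qint q (a + k) * qint q (b + k) - q powi (2 * k) * (qint q (a - k) * qint q (b - k))) * R"
    unfolding 1 2 by (simp add: algebra_simps)
  also have "\<dots> = qint q (a + b) * moment_term q a b k"
    unfolding 3 by (simp add: moment_term_def R_def mult_ac)
  finally show ?thesis by simp
qed

text \<open>
  The upper boundary term of the telescoping sum vanishes because \<open>1 / [a - N - 1]! = 0\<close>.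
\<close>
lemma sum_moment_term:
  assumes "a \<le> int N"
  shows "qint q (a + b) * (\<Sum>k = 1..N. moment_term q a b (int k)) =
         (rqfact q a * rqfact q (a - 1)) * (rqfact q b * rqfact q (b - 1))"
proof -
  define T where "T k = q powi (k\<^sup>2 - k) * (rqfact q (a + k - 1) * rqfact q (a - k)) *
                      (rqfact q (b + k - 1) * rqfact q (b - k))" for k :: int
  have "qint q (a + b) * (\<Sum>k = 1..N. moment_term q a b (int k)) =
        (\<Sum>k = 1..N. T (int k) - T (int (Suc k)))"
    unfolding sum_distrib_left moment_term_telescopes T_def by (simp add: add.commute)
  also have "\<dots> = T 1 - T (int (Suc N))"
    by (induction N) auto
  also have "T (int (Suc N)) = 0" using assms by (simp add: T_def rqfact_def)
  finally show ?thesis by (simp add: T_def)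
qed

lemma moment_eq:
  assumes "i < n" "j < m"
  shows "(\<Sum>k = - int n..int n. weight q m n k * newton q n i k * newton q m j k) =
     2 / qint q 2 * qfact q (2 * n) * qfact q (2 * m) *
     (rqfact q (int n - int i) * rqfact q (int n - int i - 1)) *
     (rqfact q (int m - int j) * rqfact q (int m - int j - 1)) / qint q (int n - int i + (int m - int j))"
proof -
  define a b where "a = int n - int i" and "b = int m - int j"
  have "qint q (a + b) > 0" using assms by (intro qint_pos) (simp add: a_def b_def)
  then have "(\<Sum>k = 1..n. moment_term q a b (int k)) =
      (rqfact q a * rqfact q (a - 1)) * (rqfact q b * rqfact q (b - 1)) / qint q (a + b)"
    using sum_moment_term[of a n b] by (simp add: a_def nonzero_eq_divide_eq mult.commute)
  then show ?thesis
    unfolding moment_eq_sum a_def[symmetric] b_def[symmetric] by simp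
qed

text \<open>
  Here \<open>n - i = 0\<close> or \<open>m - j = 0\<close>, so the weight is supported on \<open>k = 0\<close>, where it is zero.
\<close>
lemma moment_vanishes:
  assumes "i = n \<or> j = m"
  shows "(\<Sum>k = - int n..int n. weight q m n k * newton q n i k * newton q m j k) = 0"
proof -
  have "moment_term q (int n - int i) (int m - int j) (int k) = 0" if "k \<in> {1..n}" for k
    using assms that by (auto simp: moment_term_def rqfact_def)
  then show ?thesis unfolding moment_eq_sum by simp
qed

end

section \<open>The multiple sum as a determinant\<close>

lemma prod_pairs:
  fixes f :: "nat \<Rightarrow> nat \<Rightarrow> 'a :: comm_monoid_mult"
  shows "(\<Prod>(i, j) \<in> {(i, j). 1 \<le> i \<and> i < j \<and> j \<le> r}. f i j) =
         (\<Prod>j = 0..<r. \<Prod>i = 0..<j. f (Suc i) (Suc j))"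
  unfolding prod.Sigma[OF finite_atLeastLessThan ballI[OF finite_atLeastLessThan]]
  by (rule prod.reindex_bij_witness[of _ "\<lambda>(j, i). (Suc i, Suc j)" "\<lambda>(i, j). (j - 1, i - 1)"]) auto

text \<open>
  Index tuples live on \<open>{1..r}\<close>, rows and columns of determinants on \<open>{0..<r}\<close>.
\<close>
lemma sum_PiE_shift:
  fixes G :: "(nat \<Rightarrow> int) \<Rightarrow> real"
  assumes "\<And>k. G k = G (restrict k {1..r})"
  shows "(\<Sum>k \<in> {1..r} \<rightarrow>\<^sub>E S. G k) = (\<Sum>k \<in> {0..<r} \<rightarrow>\<^sub>E S. G (\<lambda>i. k (i - 1)))"
proof (rule sum.reindex_bij_witness[of _ "\<lambda>k. restrict (\<lambda>i. k (i - 1)) {1..r}"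
        "\<lambda>k. restrict (\<lambda>i. k (Suc i)) {0..<r}"])
  fix k assume k: "k \<in> {1..r} \<rightarrow>\<^sub>E S"
  then show *: "restrict (\<lambda>i. restrict (\<lambda>i. k (Suc i)) {0..<r} (i - 1)) {1..r} = k"
    by (auto simp: fun_eq_iff PiE_iff extensional_def)
  show "restrict (\<lambda>i. k (Suc i)) {0..<r} \<in> {0..<r} \<rightarrow>\<^sub>E S"
    using k by (auto simp: PiE_iff)
  show "G (\<lambda>i. restrict (\<lambda>i. k (Suc i)) {0..<r} (i - 1)) = G k"
    by (subst assms) (simp only: *)
next
  fix k assume k: "k \<in> {0..<r} \<rightarrow>\<^sub>E S"
  then show "restrict (\<lambda>i. restrict (\<lambda>i. k (i - 1)) {1..r} (Suc i)) {0..<r} = k"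
    by (auto simp: fun_eq_iff PiE_iff extensional_def)
  show "restrict (\<lambda>i. k (i - 1)) {1..r} \<in> {1..r} \<rightarrow>\<^sub>E S"
    using k by (auto simp: PiE_iff)
qed

context unit_interval_base
begin

text \<open>
  For each \<open>j\<close>, the \<open>j - 1\<close> pairs \<open>i < j\<close> contribute \<open>q\<^bsup>2(j-1)k\<^sub>j\<^esup>\<close>, which reduces the exponent
  \<open>k\<^sub>j\<^sup>2 - (2j - 1) k\<^sub>j\<close> to \<open>k\<^sub>j\<^sup>2 - k\<^sub>j\<close> for every \<open>j\<close>. In the proof, \<open>j\<close> is shifted by one.
\<close>
lemma lhs_sum_eq_lattice:
  "lhs_sum q r m n = (\<Sum>k \<in> {0..<r} \<rightarrow>\<^sub>E {- int n..int n}.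
     (\<Prod>j = 0..<r. \<Prod>i = 0..<j. qlattice q (k j) - qlattice q (k i))\<^sup>2 * (\<Prod>j = 0..<r. weight q m n (k j)))"
proof -
  define G where "G k = (\<Prod>(i, j) \<in> {(i, j). 1 \<le> i \<and> i < j \<and> j \<le> r}.
            (qnum q (of_int (k j - k i)))\<^sup>2 * (qnum q (of_int (k i + k j)))\<^sup>2) *
        (\<Prod>i=1..r.
            q powi ((k i)\<^sup>2 - (2 * int i - 1) * k i) *
            \<bar>qnum (q\<^sup>2) (of_int (k i))\<bar> *
            qbinom q (2 * int n) (int n + k i) *
            qbinom q (2 * int m) (int m + k i))" for k :: "nat \<Rightarrow> int"
  have "G k = G (restrict k {1..r})" for k
    unfolding G_def by (intro arg_cong2[of _ _ _ _ "(*)"] prod.cong) auto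
  then have "lhs_sum q r m n = (\<Sum>k \<in> {0..<r} \<rightarrow>\<^sub>E {- int n..int n}. G (\<lambda>i. k (i - 1)))"
    unfolding lhs_sum_def G_def[symmetric] by (rule sum_PiE_shift)
  moreover have "G (\<lambda>i. k (i - 1)) =
     (\<Prod>j = 0..<r. \<Prod>i = 0..<j. qlattice q (k j) - qlattice q (k i))\<^sup>2 * (\<Prod>j = 0..<r. weight q m n (k j))" for k
  proof -
    define w where "w j = \<bar>qnum (q\<^sup>2) (of_int (k j))\<bar> *
            qbinom q (2 * int n) (int n + k j) * qbinom q (2 * int m) (int m + k j)" for j
    have "G (\<lambda>i. k (i - 1)) = (\<Prod>j = 0..<r. \<Prod>i = 0..<j.
            q powi (2 * k j) * (qlattice q (k j) - qlattice q (k i))\<^sup>2) *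
       (\<Prod>j = 0..<r. q powi ((k j)\<^sup>2 - (2 * int (Suc j) - 1) * k j) * w j)"
    proof -
      have "(\<Prod>i = 1..r. f i) = (\<Prod>j = 0..<r. f (Suc j))" for f :: "nat \<Rightarrow> real"
        by (rule prod.reindex_bij_witness[of _ Suc "\<lambda>i. i - 1"]) auto
      then show ?thesis
        unfolding G_def prod_pairs qnum_of_int lattice_diff
        by (simp add: w_def mult.assoc)
    qed
    also have "\<dots> = (\<Prod>j = 0..<r. (\<Prod>i = 0..<j. qlattice q (k j) - qlattice q (k i))\<^sup>2 * weight q m n (k j))"
      unfolding prod.distrib[symmetric]
    proof (rule prod.cong[OF refl])
      fix j
      define e where "e = (k j)\<^sup>2 - (2 * int (Suc j) - 1) * k j"
      have "(q powi (2 * k j)) ^ j = q powi (2 * k j * int j)"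
        by (simp add: power_int_mult)
      moreover have "2 * k j * int j + e = (k j)\<^sup>2 - k j"
        by (simp add: e_def algebra_simps)
      ultimately have e: "(q powi (2 * k j)) ^ j * q powi e = q powi ((k j)\<^sup>2 - k j)"
        using powi_add by metis
      have "weight q m n (k j) = q powi ((k j)\<^sup>2 - k j) * w j" by (simp add: weight_def w_def)
      then show "(\<Prod>i = 0..<j. q powi (2 * k j) * (qlattice q (k j) - qlattice q (k i))\<^sup>2) *
           (q powi ((k j)\<^sup>2 - (2 * int (Suc j) - 1) * k j) * w j) =
        (\<Prod>i = 0..<j. qlattice q (k j) - qlattice q (k i))\<^sup>2 * weight q m n (k j)"
        unfolding e_def[symmetric] e[symmetric] by (simp add: prod.distrib prod_power_distrib)
    qed
    finally show ?thesis by (simp add: prod.distrib prod_power_distrib)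
  qed
  ultimately show ?thesis by simp
qed

text \<open>
  One of the two Vandermonde products is expanded in the Newton basis belonging to \<open>n\<close>, the
  other in the one belonging to \<open>m\<close>. The product on the left collects the leading coefficients of both.
\<close>
lemma lhs_sum_eq_det:
  "(\<Prod>j = 0..<r. \<Prod>i = 0..<j. q powi (int n - int i) * q powi (int m - int i)) * lhs_sum q r m n =
   fact r * fdet r (\<lambda>i j. \<Sum>k = - int n..int n. weight q m n k * newton q n i k * newton q m j k)"
proof -
  define V where "V k = (\<Prod>j = 0..<r. \<Prod>i = 0..<j. qlattice q (k j) - qlattice q (k i))" for k
  define L where "L N = (\<Prod>j = 0..<r. \<Prod>i = 0..<j. - (q powi (int N - int i)))" for N
  have newton_det: "fdet r (\<lambda>i j. newton q N i (k j)) = L N * V k" for N k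
    unfolding newton_def L_def V_def by (rule fdet_newton)
  have "fact r * fdet r (\<lambda>i j. \<Sum>k = - int n..int n. weight q m n k * newton q n i k * newton q m j k) =
        (\<Sum>k \<in> {0..<r} \<rightarrow>\<^sub>E {- int n..int n}.
          fdet r (\<lambda>i j. weight q m n (k j) * newton q n i (k j)) * fdet r (\<lambda>i j. newton q m i (k j)))"
    by (rule andreief_identity[symmetric]) simp
  also have "\<dots> = (\<Sum>k \<in> {0..<r} \<rightarrow>\<^sub>E {- int n..int n}.
          (L n * L m) * ((V k)\<^sup>2 * (\<Prod>j = 0..<r. weight q m n (k j))))"
  proof (rule sum.cong[OF refl])
    fix k
    have "fdet r (\<lambda>i j. weight q m n (k j) * newton q n i (k j)) =
          (\<Prod>j = 0..<r. weight q m n (k j)) * fdet r (\<lambda>i j. newton q n i (k j))"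
      using fdet_scale[of r "\<lambda>_. 1" "\<lambda>j. weight q m n (k j)"] by simp
    then show "fdet r (\<lambda>i j. weight q m n (k j) * newton q n i (k j)) * fdet r (\<lambda>i j. newton q m i (k j)) =
        (L n * L m) * ((V k)\<^sup>2 * (\<Prod>j = 0..<r. weight q m n (k j)))"
      by (simp add: newton_det power2_eq_square)
  qed
  also have "\<dots> = (L n * L m) * lhs_sum q r m n"
    by (simp add: lhs_sum_eq_lattice V_def sum_distrib_left)
  also have "L n * L m = (\<Prod>j = 0..<r. \<Prod>i = 0..<j. q powi (int n - int i) * q powi (int m - int i))"
    by (simp add: L_def prod.distrib[symmetric])
  finally show ?thesis by simp
qed

text \<open>
  By \<open>moment_vanishes\<close>, row \<open>n\<close> or column \<open>m\<close> of the moment matrix is zero. (Equivalently,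
  too few distinct positive values \<open>\<bar>k\<^sub>i\<bar>\<close> are available.)
\<close>
lemma lhs_sum_vanishes:
  assumes "n < r \<or> m < r"
  shows "lhs_sum q r m n = 0"
proof -
  define M where "M i j = (\<Sum>k = - int n..int n. weight q m n k * newton q n i k * newton q m j k)" for i j
  have "fdet r M = 0"
  proof (cases "n < r")
    case True
    then show ?thesis by (rule fdet_zero_row) (simp add: M_def moment_vanishes)
  next
    case False
    then have "m < r" using assms by simp
    then have "fdet r (\<lambda>i j. M j i) = 0" by (rule fdet_zero_row) (simp add: M_def moment_vanishes)
    then show ?thesis using fdet_transpose[of r M] by simp
  qed
  moreover have "(\<Prod>j = 0..<r. \<Prod>i = 0..<j. q powi (int n - int i) * q powi (int m - int i)) \<noteq> 0"
    using q0 by simp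
  ultimately show ?thesis
    using lhs_sum_eq_det[where r = r and n = n and m = m] unfolding M_def[symmetric] by auto
qed

end

section \<open>Evaluation in terms of q-factorials\<close>

text \<open>
  The source of the exponent \<open>2 \<cdot> ((r + 1) choose 3)\<close>: every pair \<open>i < j\<close> contributes
  \<open>q\<^bsup>-2(j-i)\<^esup>\<close> to the quotient of the Cauchy determinant by the leading coefficients.
\<close>
lemma sum_choose_3: "(\<Sum>j = 0..<r. \<Sum>i = 0..<j. j - i) = (r + 1) choose 3"
proof (induction r)
  case (Suc r)
  have "(\<Sum>i = 0..<r. r - i) = Suc r choose 2"
  proof -
    have "(\<Sum>i = 0..<r. r - i) = (\<Sum>i = 0..<r. Suc i)"
      by (rule sum.reindex_bij_witness[of _ "\<lambda>i. r - Suc i" "\<lambda>i. r - Suc i"]) auto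
    also have "\<dots> = Suc r choose 2"
      by (induction r) (auto simp: numeral_2_eq_2)
    finally show ?thesis .
  qed
  then show ?case using Suc by (simp add: eval_nat_numeral)
qed (simp add: eval_nat_numeral)

context unit_interval_base
begin

lemma prod_powi: "(\<Prod>x\<in>A. q powi f x) = q powi (\<Sum>x\<in>A. f x)"
  by (induction A rule: infinite_finite_induct) (simp_all add: powi_add)

text \<open>
  With \<open>x\<^sub>i = q\<^bsup>n-i\<^esup>\<close> and \<open>y\<^sub>j = q\<^bsup>m-j\<^esup>\<close> one has \<open>(1 - q) [m + n - i - j] = 1 - x\<^sub>i y\<^sub>j\<close>, so the moment matrix
  is a Cauchy matrix with rescaled rows and columns. The leading coefficients \<open>L\<close> of the Newton bases cancel
  against the factors \<open>x\<^sub>i y\<^sub>i\<close> of the differences in its numerator. The differences of q-powers give the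
  q-factorials \<open>[j]!\<close>, the denominators give the quotients \<open>F\<close>, and the powers of \<open>1 - q\<close> cancel.
\<close>
lemma lhs_sum_eq_qfact:
  assumes "r \<le> n" "r \<le> m"
  shows "lhs_sum q r m n = fact r * (2 / qint q 2) ^ r * q powi (- 2 * int ((r + 1) choose 3)) *
     (\<Prod>i = 0..<r. (qfact q i)\<^sup>2 *
        (qfact q (2 * n) * (rqfact q (int n - int i) * rqfact q (int n - int i - 1))) *
        (qfact q (2 * m) * (rqfact q (int m - int i) * rqfact q (int m - int i - 1))) *
        (qfact q (m + n - i - r) / qfact q (m + n - i)))"
proof -
  define x y where "x i = q powi (int n - int i)" and "y i = q powi (int m - int i)" for i
  define \<alpha> where "\<alpha> i = qfact q (2 * n) * (rqfact q (int n - int i) * rqfact q (int n - int i - 1))" for i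
  define \<beta> where "\<beta> i = qfact q (2 * m) * (rqfact q (int m - int i) * rqfact q (int m - int i - 1))" for i
  define F where "F i = qfact q (m + n - i) / qfact q (m + n - i - r)" for i
  define L where "L = (\<Prod>j = 0..<r. \<Prod>i = 0..<j. x i * y i)"
  define E where "E = q powi (- 2 * int ((r + 1) choose 3))"
  define P where "P = (\<Prod>i = 0..<r. (qfact q i)\<^sup>2)"
  have pos: "x i > 0" "y i > 0" for i using q0 by (simp_all add: x_def y_def)
  have xy: "1 - x i * y j = (1 - q) * qint q (int n - int i + (int m - int j))" for i j
    using q1 powi_add by (simp add: x_def y_def qint_def)
  have step: "z j - z i = (1 - q) * z i * q powi (- (int j - int i)) * qint q (int j - int i)"
    if z: "z = (\<lambda>i. q powi (N - int i))" for z i j N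
  proof -
    have e: "q powi (- (int j - int i)) * q powi (int j - int i) = 1"
      unfolding powi_add[symmetric] by simp
    have "z j = z i * q powi (- (int j - int i))"
      unfolding z powi_add[symmetric] by simp
    then have "z j - z i = z i * (q powi (- (int j - int i)) * (1 - q powi (int j - int i)))"
      using e by (simp add: right_diff_distrib)
    also have "1 - q powi (int j - int i) = (1 - q) * qint q (int j - int i)"
      using q1 by (simp add: qint_def)
    finally show ?thesis by simp
  qed
  have x_step: "x j - x i = (1 - q) * x i * q powi (- (int j - int i)) * qint q (int j - int i)"
    and y_step: "y j - y i = (1 - q) * y i * q powi (- (int j - int i)) * qint q (int j - int i)" for i j
    by (rule step[of _ "int n"], simp add: x_def fun_eq_iff, rule step[of _ "int m"], simp add: y_def fun_eq_iff)
  have det: "fdet r (\<lambda>i j. 1 / (1 - x i * y j)) =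
        (\<Prod>j = 0..<r. \<Prod>i = 0..<j. (x j - x i) * (y j - y i)) /
        (\<Prod>i = 0..<r. \<Prod>j = 0..<r. 1 - x i * y j)"
  proof (rule cauchy_determinant)
    fix i j assume "i < r" "j < r"
    then have "1 - x i * y j > 0" using assms q1 by (simp add: xy qint_pos)
    then show "x i * y j \<noteq> 1" by simp
  next
    fix i j :: nat assume "i < j"
    then have "y j - y i \<noteq> 0"
      using qint_pos[of "int j - int i"] q0 q1 pos[of i] unfolding y_step by simp
    then show "y i \<noteq> y j" by simp
  qed (use pos in \<open>auto simp: less_le\<close>)
  have num: "(\<Prod>j = 0..<r. \<Prod>i = 0..<j. (x j - x i) * (y j - y i)) =
        L * ((\<Prod>j = 0..<r. ((1 - q)\<^sup>2) ^ j) * E * P)"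
  proof -
    have "(\<Prod>j = 0..<r. \<Prod>i = 0..<j. (x j - x i) * (y j - y i)) =
          (\<Prod>j = 0..<r. \<Prod>i = 0..<j. (x i * y i) * ((1 - q)\<^sup>2 *
             (q powi (- 2 * (int j - int i))) * (qint q (int j - int i))\<^sup>2))"
    proof (intro prod.cong refl)
      fix j i assume "j \<in> {0..<r}" "i \<in> {0..<j}"
      define e where "e = q powi (- (int j - int i))"
      have "- 2 * (int j - int i) = - (int j - int i) + - (int j - int i)" by simp
      then have "q powi (- 2 * (int j - int i)) = e * e" unfolding e_def powi_add[symmetric] by simp
      then show "(x j - x i) * (y j - y i) = (x i * y i) * ((1 - q)\<^sup>2 *
             (q powi (- 2 * (int j - int i))) * (qint q (int j - int i))\<^sup>2)"
        unfolding x_step y_step e_def[symmetric] by (simp add: power2_eq_square)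
    qed
    also have "\<dots> = L * ((\<Prod>j = 0..<r. ((1 - q)\<^sup>2) ^ j) *
        (\<Prod>j = 0..<r. \<Prod>i = 0..<j. q powi (- 2 * (int j - int i))) *
        (\<Prod>j = 0..<r. (\<Prod>i = 0..<j. qint q (int j - int i))\<^sup>2))"
      by (simp only: L_def prod.distrib prod_constant card_atLeastLessThan diff_zero prod_power_distrib)
    also have "(\<Prod>j = 0..<r. \<Prod>i = 0..<j. q powi (- 2 * (int j - int i))) = E"
    proof -
      have "(\<Sum>j = 0..<r. \<Sum>i = 0..<j. - 2 * (int j - int i)) = - 2 * int (\<Sum>j = 0..<r. \<Sum>i = 0..<j. j - i)"
        by (simp add: sum_distrib_left of_nat_diff)
      then show ?thesis unfolding prod_powi E_def sum_choose_3 by simp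
    qed
    also have "(\<Prod>j = 0..<r. (\<Prod>i = 0..<j. qint q (int j - int i))\<^sup>2) = P"
    proof -
      have "(\<Prod>i = 0..<j. qint q (int j - int i)) = qfact q j" for j
        unfolding qfact_def
        by (rule prod.reindex_bij_witness[of _ "\<lambda>i. j - Suc i" "\<lambda>i. j - Suc i"]) (auto simp: of_nat_diff)
      then show ?thesis by (simp add: P_def)
    qed
    finally show ?thesis .
  qed
  have den: "(\<Prod>i = 0..<r. \<Prod>j = 0..<r. 1 - x i * y j) = ((1 - q) ^ r) ^ r * (\<Prod>i = 0..<r. F i)"
  proof -
    have "(\<Prod>j = 0..<r. 1 - x i * y j) = (1 - q) ^ r * F i" if "i < r" for i
    proof -
      have "(\<Prod>j = 0..<s. qint q (int n - int i + (int m - int j))) * qfact q (m + n - i - s) = qfact q (m + n - i)"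
        if "s \<le> r" for s using that
      proof (induction s)
        case (Suc s)
        define t where "t = m + n - i - Suc s"
        have t: "m + n - i - s = Suc t" using Suc.prems assms \<open>i < r\<close> by (simp add: t_def)
        have "int n - int i + (int m - int s) = int (Suc t)"
          using Suc.prems assms \<open>i < r\<close> by (simp add: t_def)
        then show ?case using Suc unfolding t_def[symmetric] t
          by (simp only: prod.atLeast0_lessThan_Suc qfact_Suc mult.assoc)
      qed simp
      from this[of r] have "(\<Prod>j = 0..<r. qint q (int n - int i + (int m - int j))) = F i"
        using qfact_pos[of "m + n - i - r"] by (simp add: F_def nonzero_eq_divide_eq less_le)
      then show ?thesis unfolding xy prod.distrib by simp
    qed
    then show ?thesis by (simp add: prod.distrib)
  qed
  \<comment> \<open>the balance of the powers of \<open>1 - q\<close> in entries, numerator and denominator: \<open>s + s (s - 1) = s\<^sup>2\<close>\<close>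
  have power: "c ^ s * (\<Prod>j = 0..<s. (c\<^sup>2) ^ j) = (c ^ s) ^ s" for c :: real and s
  proof (induction s)
    case (Suc s)
    have "c ^ Suc s * (\<Prod>j = 0..<Suc s. (c\<^sup>2) ^ j) = (c ^ s * (\<Prod>j = 0..<s. (c\<^sup>2) ^ j)) * (c * (c\<^sup>2) ^ s)"
      by simp
    also have "\<dots> = (c ^ Suc s) ^ Suc s"
      unfolding Suc.IH by (simp add: power_mult[symmetric] power_add[symmetric] power_Suc[symmetric] algebra_simps mult_2_right del: power_Suc)
    finally show ?case .
  qed simp
  have "L * lhs_sum q r m n = fact r * fdet r (\<lambda>i j. \<Sum>k = - int n..int n. weight q m n k * newton q n i k * newton q m j k)"
    using lhs_sum_eq_det by (simp add: L_def x_def y_def)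
  also have "fdet r (\<lambda>i j. \<Sum>k = - int n..int n. weight q m n k * newton q n i k * newton q m j k) =
     fdet r (\<lambda>i j. (2 / qint q 2 * \<alpha> i * (1 - q)) * \<beta> j * (1 / (1 - x i * y j)))"
  proof (rule fdet_cong)
    fix i j assume "i < r" "j < r"
    then have "i < n" "j < m" using assms by auto
    from moment_eq[OF this] show "(\<Sum>k = - int n..int n. weight q m n k * newton q n i k * newton q m j k) =
       (2 / qint q 2 * \<alpha> i * (1 - q)) * \<beta> j * (1 / (1 - x i * y j))"
      unfolding xy \<alpha>_def \<beta>_def using q1 by simp
  qed
  also have "\<dots> = (\<Prod>i = 0..<r. 2 / qint q 2 * \<alpha> i * (1 - q)) * (\<Prod>i = 0..<r. \<beta> i) *
       (L * ((\<Prod>j = 0..<r. ((1 - q)\<^sup>2) ^ j) * E * P) / (((1 - q) ^ r) ^ r * (\<Prod>i = 0..<r. F i)))"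
    unfolding fdet_scale det num den ..
  also have "\<dots> = L * ((2 / qint q 2) ^ r * E * P * (\<Prod>i = 0..<r. \<alpha> i) * (\<Prod>i = 0..<r. \<beta> i) / (\<Prod>i = 0..<r. F i))"
  proof -
    have "(\<Prod>i = 0..<r. 2 / qint q 2 * \<alpha> i * (1 - q)) = (2 / qint q 2) ^ r * (\<Prod>i = 0..<r. \<alpha> i) * (1 - q) ^ r"
      by (simp only: prod.distrib prod_constant card_atLeastLessThan diff_zero)
    moreover have "(S * a * A) * b * (L * (B * E * P) / ((A * B) * f)) = L * (S * E * P * a * b / f)"
      if "A \<noteq> 0" "B \<noteq> 0" for S A B a b f :: real
      using that by simp
    moreover have "(\<Prod>j = 0..<r. ((1 - q)\<^sup>2) ^ j) \<noteq> 0" "(1 - q) ^ r \<noteq> 0" using q1 by auto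
    ultimately show ?thesis
      unfolding power[of "1 - q" r, symmetric] by presburger
  qed
  finally have "L * lhs_sum q r m n = L * (fact r * ((2 / qint q 2) ^ r * E * P *
      (\<Prod>i = 0..<r. \<alpha> i) * (\<Prod>i = 0..<r. \<beta> i) / (\<Prod>i = 0..<r. F i)))"
    by simp
  moreover have "L \<noteq> 0" using pos by (simp add: L_def less_le)
  ultimately have "lhs_sum q r m n = fact r * ((2 / qint q 2) ^ r * E * P *
      (\<Prod>i = 0..<r. \<alpha> i) * (\<Prod>i = 0..<r. \<beta> i) / (\<Prod>i = 0..<r. F i))"
    by (rule mult_left_cancel[THEN iffD1, rotated])
  also have "\<dots> = fact r * (2 / qint q 2) ^ r * E *
     (\<Prod>i = 0..<r. (qfact q i)\<^sup>2 * \<alpha> i * \<beta> i * (1 / F i))"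
    by (simp add: P_def prod.distrib prod_dividef)
  finally show ?thesis by (simp add: E_def \<alpha>_def \<beta>_def F_def)
qed

end

section \<open>The q-Gamma function\<close>

context unit_interval_base
begin

lemma convergent_qpoch: "convergent_prod (\<lambda>k. 1 - a * q ^ k)"
proof -
  have "summable (\<lambda>k. norm ((1 - a * q ^ k) - 1))"
    using q0 q1 by (simp add: abs_mult power_abs summable_mult summable_geometric)
  then show ?thesis
    using abs_convergent_prod_conv_summable abs_convergent_prod_imp_convergent_prod by blast
qed

lemma qpoch_inf_split: "qpoch_inf a q = (\<Prod>i<n. 1 - a * q ^ i) * qpoch_inf (a * q ^ n) q"
  using has_prod_unique[OF has_prod_ignore_initial_segment'[OF convergent_qpoch[of a], of n]]
  by (simp add: qpoch_inf_def power_add mult_ac)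

lemma qpoch_factor_bounds:
  assumes "0 \<le> a" "a < 1"
  shows "0 < 1 - a * q ^ k" "1 - a * q ^ k \<le> 1"
proof -
  have "a * q ^ k \<le> a * 1" using assms q0 q1 by (intro mult_left_mono) (auto simp: power_le_one)
  then show "0 < 1 - a * q ^ k" using assms by simp
  show "1 - a * q ^ k \<le> 1" using assms q0 by simp
qed

lemma qpoch_inf_pos: "0 \<le> a \<Longrightarrow> a < 1 \<Longrightarrow> 0 < qpoch_inf a q"
  unfolding qpoch_inf_def
  by (rule less_0_prodinf) (use convergent_qpoch qpoch_factor_bounds(1) in blast)+

text \<open>
  Together with \<open>qpoch_inf_pos\<close> this bounds the product away from zero on \<open>[0, b]\<close>, which
\<close>
lemma qpoch_inf_antimono:
  assumes "0 \<le> a" "a \<le> b" "b < 1"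
  shows "qpoch_inf b q \<le> qpoch_inf a q"
  unfolding qpoch_inf_def
proof (rule prodinf_le)
  fix k
  have "a * q ^ k \<le> b * q ^ k" using assms q0 by (intro mult_right_mono) auto
  then show "0 \<le> 1 - b * q ^ k \<and> 1 - b * q ^ k \<le> 1 - a * q ^ k"
    using qpoch_factor_bounds(1)[of b k] assms by simp
qed (use convergent_qpoch convergent_prod_has_prod in blast)+

lemma qGamma_Suc: "qGamma q (real k + 1) = qfact q k"
proof -
  have "(\<Prod>i<k. 1 - q * q ^ i) = qpoch q q k"
    unfolding qpoch_def by (rule prod.reindex_bij_witness[of _ "\<lambda>j. j - 1" Suc]) auto
  then have "(\<Prod>i<k. 1 - q * q ^ i) = (1 - q) ^ k * qfact q k"
    by (simp add: qpoch_eq_qfact)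
  moreover have "q * q ^ k < 1" using q0 q1 power_Suc_less_one[of q k] by simp
  then have "qpoch_inf (q * q ^ k) q > 0" using q0 by (intro qpoch_inf_pos) auto
  moreover have "q powr (real k + 1) = q * q ^ k"
    using q0 by (simp add: powr_add powr_realpow)
  moreover have "(1 - q) powr (1 - (real k + 1)) = 1 / (1 - q) ^ k"
    using q1 by (simp add: powr_minus powr_realpow divide_inverse)
  ultimately show ?thesis
    using qpoch_inf_split[of q k] q1 by (simp add: qGamma_def)
qed

lemma lhs_sum_eq_rhs_prod:
  assumes "r \<le> n" "r \<le> m"
  shows "lhs_sum q r m n = rhs_prod q r (real m) (real n)"
proof -
  have shift: "(\<Prod>i = 1..r. f i) = (\<Prod>i = 0..<r. f (Suc i))" for f :: "nat \<Rightarrow> real"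
    by (rule prod.reindex_bij_witness[of _ Suc "\<lambda>i. i - 1"]) auto
  have q2: "qnum q 2 = qint q 2" using qnum_of_int[of 2] by simp
  have G: "qGamma q z = qfact q k" if "z = real k + 1" for z k
    using that qGamma_Suc by simp
  show ?thesis
    unfolding lhs_sum_eq_qfact[OF assms] rhs_prod_def shift q2
  proof (rule arg_cong2[of _ _ _ _ "(*)"], rule refl, rule prod.cong, rule refl)
    fix i assume "i \<in> {0..<r}"
    then have i: "i < r" "i < n" "i < m" using assms by auto
    have R: "rqfact q (int N - int i) = 1 / qfact q (N - i)" "rqfact q (int N - int i - 1) = 1 / qfact q (N - i - 1)"
      if "i < N" for N
    proof -
      have "nat (int N - int i) = N - i" "nat (int N - int i - 1) = N - i - 1" by simp_all
      then show "rqfact q (int N - int i) = 1 / qfact q (N - i)" "rqfact q (int N - int i - 1) = 1 / qfact q (N - i - 1)"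
        using that by (simp_all add: rqfact_def)
    qed
    have "qGamma q (real (Suc i)) = qfact q i" "qGamma q (2 * real n + 1) = qfact q (2 * n)"
      "qGamma q (2 * real m + 1) = qfact q (2 * m)"
      "qGamma q (real n - real (Suc i) + 2) = qfact q (n - i)"
      "qGamma q (real n - real (Suc i) + 1) = qfact q (n - i - 1)"
      "qGamma q (real m - real (Suc i) + 2) = qfact q (m - i)"
      "qGamma q (real m - real (Suc i) + 1) = qfact q (m - i - 1)"
      "qGamma q (real m + real n - real (Suc i) - real r + 2) = qfact q (m + n - i - r)"
      "qGamma q (real m + real n - real (Suc i) + 2) = qfact q (m + n - i)"
      using i assms by (auto intro!: G simp: of_nat_diff)
    then show "(qfact q i)\<^sup>2 *
        (qfact q (2 * n) * (rqfact q (int n - int i) * rqfact q (int n - int i - 1))) *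
        (qfact q (2 * m) * (rqfact q (int m - int i) * rqfact q (int m - int i - 1))) *
        (qfact q (m + n - i - r) / qfact q (m + n - i)) =
      (qGamma q (real (Suc i)))\<^sup>2 * qGamma q (2 * real n + 1) /
        (qGamma q (real n - real (Suc i) + 2) * qGamma q (real n - real (Suc i) + 1)) *
      (qGamma q (2 * real m + 1) /
        (qGamma q (real m - real (Suc i) + 2) * qGamma q (real m - real (Suc i) + 1))) *
      (qGamma q (real m + real n - real (Suc i) - real r + 2) / qGamma q (real m + real n - real (Suc i) + 2))"
      using R[OF i(2)] R[OF i(3)] by simp
  qed
qed

end

section \<open>Orders of vanishing of the product side\<close>

text \<open>Negative \<open>a\<close> bounds the order of a pole.\<close>
definition vanishing_order_ge :: "(real \<Rightarrow> real) \<Rightarrow> int \<Rightarrow> bool" where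
  "vanishing_order_ge f a \<longleftrightarrow> f \<in> O[at 0](\<lambda>\<epsilon>. \<epsilon> powi a)"

lemma vanishing_order_ge_const: "vanishing_order_ge (\<lambda>_. c) 0"
  by (simp add: vanishing_order_ge_def)

lemma vanishing_order_ge_mult:
  assumes "vanishing_order_ge f a" "vanishing_order_ge g b"
  shows "vanishing_order_ge (\<lambda>\<epsilon>. f \<epsilon> * g \<epsilon>) (a + b)"
proof -
  have "(\<lambda>\<epsilon>. f \<epsilon> * g \<epsilon>) \<in> O[at 0](\<lambda>\<epsilon>. \<epsilon> powi a * \<epsilon> powi b)"
    using assms unfolding vanishing_order_ge_def by (rule landau_o.big.mult)
  also have "(\<lambda>\<epsilon>::real. \<epsilon> powi a * \<epsilon> powi b) \<in> \<Theta>[at 0](\<lambda>\<epsilon>. \<epsilon> powi (a + b))"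
    by (rule bigthetaI_cong) (auto simp: eventually_at power_int_add intro!: exI[of _ 1])
  finally show ?thesis by (simp add: vanishing_order_ge_def)
qed

lemma vanishing_order_ge_prod:
  assumes "\<And>i. i \<in> A \<Longrightarrow> vanishing_order_ge (f i) (a i)"
  shows "vanishing_order_ge (\<lambda>\<epsilon>. \<Prod>i\<in>A. f i \<epsilon>) (\<Sum>i\<in>A. a i)"
  using assms
  by (induction A rule: infinite_finite_induct)
     (auto intro!: vanishing_order_ge_mult vanishing_order_ge_const)

lemma vanishing_order_ge_tendsto_0:
  assumes "vanishing_order_ge f a" "a \<ge> 1"
  shows "(f \<longlongrightarrow> 0) (at 0)"
proof -
  have "((\<lambda>\<epsilon>::real. \<epsilon> ^ nat a) \<longlongrightarrow> 0 ^ nat a) (at 0)" by (intro tendsto_intros)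
  moreover have "(0::real) ^ nat a = 0" using assms(2) by simp
  ultimately have "((\<lambda>\<epsilon>::real. \<epsilon> powi a) \<longlongrightarrow> 0) (at 0)"
    using assms(2) by (simp add: power_int_def)
  then have "(\<lambda>\<epsilon>::real. \<epsilon> powi a) \<in> o[at 0](\<lambda>_. 1)" by (simp add: smalloI_tendsto)
  with assms(1) have "f \<in> o[at 0](\<lambda>_. 1)"
    unfolding vanishing_order_ge_def by (rule landau_o.big_small_trans)
  then show ?thesis using smalloD_tendsto by fastforce
qed

text \<open>
  The order of the pole of \<open>\<Gamma>\<^sub>q\<close>, equivalently of the zero of \<open>1 / \<Gamma>\<^sub>q\<close>, at the integer \<open>c\<close>.
\<close>
definition pole_order :: "int \<Rightarrow> int" where
  "pole_order c = (if c \<le> 0 then 1 else 0)"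

lemma sum_pole_order: "(\<Sum>i = 1..r. pole_order (c - int i)) = max 0 (int r + 1 - max c 1)"
  by (induction r) (auto simp: pole_order_def max_def)

text \<open>
  The zeros outnumber the poles, counted over the factors of the product. The argument
  \<open>m + n - i - r + 2\<close> is a pole for at most \<open>max 0 (2r - m - n - 1)\<close> values of \<open>i\<close>. If \<open>n < r\<close>, the two reciprocals
  with \<open>n\<close> have \<open>2(r - n) - 1\<close> zeros in total, and likewise for \<open>m\<close>; if both \<open>n < r\<close> and \<open>m < r\<close>, the surplus is
  at least \<open>2r - m - n - 1\<close>, and if only \<open>n < r\<close>, it is at least \<open>m - n\<close> or there are no poles. Poles and zeros
  need not occur at the same \<open>i\<close>, so only the total order can be compared.
\<close>
lemma total_order_pos:
  assumes "n < r \<or> m < r"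
  shows "1 \<le> (\<Sum>i = 1..r. pole_order (int n + 2 - int i) + pole_order (int n + 1 - int i) +
       (pole_order (int m + 2 - int i) + pole_order (int m + 1 - int i)) +
       (- pole_order (int m + int n - int r + 2 - int i) + pole_order (int m + int n + 2 - int i)))"
proof -
  define Z where "Z c = (\<Sum>i = 1..r. pole_order (c - int i))" for c
  have Z: "Z c \<ge> 0" "Z c \<ge> int r + 1 - c \<or> c < 1" for c
    unfolding Z_def sum_pole_order by auto
  \<comment> \<open>an upper bound, for the pole count, which enters with a negative sign\<close>
  have upper: "Z c = 0 \<or> Z c \<le> int r + 1 - c" for c
    unfolding Z_def sum_pole_order by auto
  have "1 \<le> Z (int n + 2) + Z (int n + 1) + (Z (int m + 2) + Z (int m + 1)) +
        (- Z (int m + int n - int r + 2) + Z (int m + int n + 2))"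
    using Z(2)[of "int n + 2"] Z(2)[of "int n + 1"] Z(2)[of "int m + 2"] Z(2)[of "int m + 1"]
      Z(1)[of "int n + 2"] Z(1)[of "int n + 1"] Z(1)[of "int m + 2"] Z(1)[of "int m + 1"]
      Z(1)[of "int m + int n + 2"] upper[of "int m + int n - int r + 2"] assms
    by linarith
  then show ?thesis by (simp add: Z_def sum.distrib sum_negf sum_subtractf)
qed

context unit_interval_base
begin

lemma qpoch_inf_bigtheta:
  assumes "c \<ge> 1"
  shows "(\<lambda>\<epsilon>. qpoch_inf (q powr (of_int c + s * \<epsilon>)) q) \<in> \<Theta>[at 0](\<lambda>_. 1)"
proof (rule bigthetaI')
  define b where "b = q powr (1 / 2)"
  have b: "0 \<le> b" "b < 1" using q0 q1 by (auto simp: b_def powr_half_sqrt)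
  show "qpoch_inf b q > 0" using qpoch_inf_pos[OF b] .
  have "((\<lambda>\<epsilon>. s * \<epsilon>) \<longlongrightarrow> s * 0) (at 0)" by (intro tendsto_intros)
  then have "\<forall>\<^sub>F \<epsilon> in at 0. s * \<epsilon> > - 1 / 2" by (rule order_tendstoD) simp
  then show "\<forall>\<^sub>F \<epsilon> in at 0. qpoch_inf b q * norm (1::real) \<le> norm (qpoch_inf (q powr (of_int c + s * \<epsilon>)) q) \<and>
      norm (qpoch_inf (q powr (of_int c + s * \<epsilon>)) q) \<le> 1 * norm (1::real)"
  proof eventually_elim
    case (elim \<epsilon>)
    let ?a = "q powr (of_int c + s * \<epsilon>)"
    have "real_of_int c \<ge> 1" using assms by simp
    then have "1 / 2 \<le> of_int c + s * \<epsilon>" using elim by linarith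
    then have a: "0 \<le> ?a" "?a \<le> b" using q0 q1 by (auto simp: b_def powr_mono')
    then have "qpoch_inf b q \<le> qpoch_inf ?a q" "qpoch_inf ?a q \<le> qpoch_inf 0 q" "0 < qpoch_inf ?a q"
      using qpoch_inf_antimono qpoch_inf_pos b by (auto simp: order.strict_trans1)
    then show ?case by (simp add: qpoch_inf_def)
  qed
qed simp

lemma qpoch_inf_powr_split:
  "qpoch_inf (q powr x) q = (\<Prod>l<K. 1 - q powr (x + real l)) * qpoch_inf (q powr (x + real K)) q"
  using qpoch_inf_split[of "q powr x" K] q0 by (simp add: powr_add powr_realpow)

lemma regular_factor_bigtheta:
  assumes "d \<noteq> 0"
  shows "(\<lambda>\<epsilon>. 1 - q powr (of_int d + s * \<epsilon>)) \<in> \<Theta>[at 0](\<lambda>_. 1)"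
proof (rule bigthetaI_tendsto)
  have "((\<lambda>\<epsilon>. 1 - q powr (of_int d + s * \<epsilon>)) \<longlongrightarrow> 1 - q powr (of_int d + s * 0)) (at 0)"
    using q0 by (intro tendsto_intros) auto
  then show "((\<lambda>\<epsilon>. (1 - q powr (of_int d + s * \<epsilon>)) / 1) \<longlongrightarrow> 1 - q powr of_int d) (at 0)" by simp
  show "1 - q powr of_int d \<noteq> 0" using q0 q1 assms by simp
qed

lemma vanishing_factor_bigtheta:
  assumes "s \<noteq> 0"
  shows "(\<lambda>\<epsilon>. 1 - q powr (s * \<epsilon>)) \<in> \<Theta>[at 0](\<lambda>\<epsilon>. \<epsilon>)"
proof (rule bigthetaI_tendsto)
  have "((\<lambda>\<epsilon>. 1 - q powr (s * \<epsilon>)) has_real_derivative - (s * ln q)) (at 0)"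
    using q0 by (auto intro!: derivative_eq_intros)
  then show "((\<lambda>\<epsilon>. (1 - q powr (s * \<epsilon>)) / \<epsilon>) \<longlongrightarrow> - (s * ln q)) (at 0)"
    using q0 by (simp add: has_field_derivative_iff)
  show "- (s * ln q) \<noteq> 0" using q0 q1 assms by simp
qed

text \<open>
  Near an integer \<open>c \<le> 0\<close>, splitting off the first \<open>1 - c\<close> factors of
  \<open>(q\<^bsup>c+s\<epsilon>\<^esup>; q)\<^sub>\<infinity>\<close> isolates the only vanishing one, \<open>1 - q\<^bsup>s\<epsilon>\<^esup>\<close>, which is of exact order \<open>\<epsilon>\<close>. The general
  slope \<open>s\<close> covers the arguments that contain both perturbed parameters, where \<open>s = 2\<close>.
\<close>
lemma qGamma_bigtheta:
  assumes "s \<noteq> 0"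
  shows "(\<lambda>\<epsilon>. qGamma q (of_int c + s * \<epsilon>)) \<in> \<Theta>[at 0](\<lambda>\<epsilon>. \<epsilon> powi (- pole_order c))"
proof -
  have den: "(\<lambda>\<epsilon>. qpoch_inf (q powr (of_int c + s * \<epsilon>)) q) \<in> \<Theta>[at 0](\<lambda>\<epsilon>. \<epsilon> powi (pole_order c))"
  proof (cases "c \<le> 0")
    case True
    define K where "K = nat (- c)"
    have K: "of_int c = - real K" using True by (simp add: K_def)
    have eq: "qpoch_inf (q powr (of_int c + s * \<epsilon>)) q =
        (\<Prod>l<K. 1 - q powr (of_int (c + int l) + s * \<epsilon>)) * (1 - q powr (s * \<epsilon>)) *
        qpoch_inf (q powr (of_int 1 + s * \<epsilon>)) q" for \<epsilon>
      using qpoch_inf_powr_split[of "of_int c + s * \<epsilon>" "Suc K"] by (simp add: K algebra_simps)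
    have "(\<lambda>\<epsilon>. \<Prod>l\<in>A. 1 - q powr (of_int (c + int l) + s * \<epsilon>)) \<in> \<Theta>[at 0](\<lambda>_. 1)" if "A \<subseteq> {..<K}" for A
      using finite_subset[OF that finite_lessThan] that
    proof (induction A rule: finite_induct)
      case (insert l A)
      from insert.prems have "l < K" by simp
      then have "c + int l \<noteq> 0" unfolding K_def by linarith
      from landau_theta.mult[OF regular_factor_bigtheta[OF this, of s] insert.IH] insert.hyps insert.prems
      show ?case by simp
    qed simp
    from landau_theta.mult[OF landau_theta.mult[OF this[OF subset_refl] vanishing_factor_bigtheta[OF assms]]
       qpoch_inf_bigtheta[of 1 s]]
    show ?thesis using True unfolding eq by (simp add: pole_order_def)
  next
    case False
    then show ?thesis using qpoch_inf_bigtheta[of c s] by (simp add: pole_order_def)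
  qed
  have num: "(\<lambda>\<epsilon>. (1 - q) powr (1 - (of_int c + s * \<epsilon>)) * qpoch_inf q q) \<in> \<Theta>[at 0](\<lambda>_. 1)"
  proof (rule bigthetaI_tendsto)
    have "((\<lambda>\<epsilon>. (1 - q) powr (1 - (of_int c + s * \<epsilon>)) * qpoch_inf q q) \<longlongrightarrow>
          (1 - q) powr (1 - (of_int c + s * 0)) * qpoch_inf q q) (at 0)"
      using q1 by (intro tendsto_intros) auto
    then show "((\<lambda>\<epsilon>. (1 - q) powr (1 - (of_int c + s * \<epsilon>)) * qpoch_inf q q / 1) \<longlongrightarrow>
          (1 - q) powr (1 - of_int c) * qpoch_inf q q) (at 0)" by simp
    show "(1 - q) powr (1 - of_int c) * qpoch_inf q q \<noteq> 0"
      using q0 q1 qpoch_inf_pos[of q] by simp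
  qed
  have "(\<lambda>\<epsilon>. inverse (qpoch_inf (q powr (of_int c + s * \<epsilon>)) q)) \<in> \<Theta>[at 0](\<lambda>\<epsilon>. inverse (\<epsilon> powi (pole_order c)))"
    unfolding bigtheta_inverse by (rule den)
  from landau_theta.mult[OF num this] show ?thesis
    unfolding qGamma_def power_int_minus divide_inverse mult_1 .
qed

lemma vanishing_order_ge_qGamma:
  assumes "s \<noteq> 0" "\<And>\<epsilon>. z \<epsilon> = of_int c + s * \<epsilon>"
  shows "vanishing_order_ge (\<lambda>\<epsilon>. qGamma q (z \<epsilon>)) (- pole_order c)"
  using qGamma_bigtheta[OF assms(1), of c] unfolding vanishing_order_ge_def assms(2) by (rule bigthetaD1)

lemma vanishing_order_ge_inverse_qGamma:
  assumes "s \<noteq> 0" "\<And>\<epsilon>. z \<epsilon> = of_int c + s * \<epsilon>"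
  shows "vanishing_order_ge (\<lambda>\<epsilon>. inverse (qGamma q (z \<epsilon>))) (pole_order c)"
proof -
  have "(\<lambda>\<epsilon>. inverse (qGamma q (of_int c + s * \<epsilon>))) \<in> \<Theta>[at 0](\<lambda>\<epsilon>. inverse (\<epsilon> powi (- pole_order c)))"
    using qGamma_bigtheta[OF assms(1), of c] by (simp only: bigtheta_inverse)
  then show ?thesis unfolding vanishing_order_ge_def assms(2)
    by (intro bigthetaD1) (simp only: power_int_minus inverse_inverse_eq)
qed

text \<open>
  The orders of all factors add up, so \<open>total_order_pos\<close> applies. The numerator factors
  \<open>\<Gamma>\<^sub>q(2n + 1)\<close> and \<open>\<Gamma>\<^sub>q(2m + 1)\<close> have order zero.
\<close>
lemma rhs_prod_tendsto_0:
  assumes "n < r \<or> m < r"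
  shows "((\<lambda>\<epsilon>. rhs_prod q r (real m + \<epsilon>) (real n + \<epsilon>)) \<longlongrightarrow> 0) (at 0)"
proof -
  define N where "N i = pole_order (int n + 2 - int i) + pole_order (int n + 1 - int i) +
       (pole_order (int m + 2 - int i) + pole_order (int m + 1 - int i)) +
       (- pole_order (int m + int n - int r + 2 - int i) + pole_order (int m + int n + 2 - int i))" for i
  define f where "f i \<epsilon> =
        ((qGamma q (real i))\<^sup>2 * qGamma q (2 * (real n + \<epsilon>) + 1)
           / (qGamma q ((real n + \<epsilon>) - real i + 2) * qGamma q ((real n + \<epsilon>) - real i + 1))) *
        (qGamma q (2 * (real m + \<epsilon>) + 1)
           / (qGamma q ((real m + \<epsilon>) - real i + 2) * qGamma q ((real m + \<epsilon>) - real i + 1))) *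
        (qGamma q ((real m + \<epsilon>) + (real n + \<epsilon>) - real i - real r + 2)
           / qGamma q ((real m + \<epsilon>) + (real n + \<epsilon>) - real i + 2))" for i \<epsilon>
  have order_f: "vanishing_order_ge (f i) (N i)" for i
  proof -
    have num: "vanishing_order_ge (\<lambda>\<epsilon>. qGamma q (2 * (real n + \<epsilon>) + 1)) (- pole_order (2 * int n + 1))"
      "vanishing_order_ge (\<lambda>\<epsilon>. qGamma q (2 * (real m + \<epsilon>) + 1)) (- pole_order (2 * int m + 1))"
      "vanishing_order_ge (\<lambda>\<epsilon>. qGamma q ((real m + \<epsilon>) + (real n + \<epsilon>) - real i - real r + 2))
         (- pole_order (int m + int n - int r + 2 - int i))"
      by (rule vanishing_order_ge_qGamma[of 2]; simp)+
    have den: "vanishing_order_ge (\<lambda>\<epsilon>. inverse (qGamma q ((real N + \<epsilon>) - real i + 2))) (pole_order (int N + 2 - int i))"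
      "vanishing_order_ge (\<lambda>\<epsilon>. inverse (qGamma q ((real N + \<epsilon>) - real i + 1))) (pole_order (int N + 1 - int i))" for N
      by (rule vanishing_order_ge_inverse_qGamma[of 1]; simp)+
    have den2: "vanishing_order_ge (\<lambda>\<epsilon>. inverse (qGamma q ((real m + \<epsilon>) + (real n + \<epsilon>) - real i + 2)))
        (pole_order (int m + int n + 2 - int i))"
      by (rule vanishing_order_ge_inverse_qGamma[of 2]; simp)
    have "vanishing_order_ge (\<lambda>\<epsilon>. ((qGamma q (real i))\<^sup>2 * qGamma q (2 * (real n + \<epsilon>) + 1)) *
        (inverse (qGamma q ((real n + \<epsilon>) - real i + 2)) * inverse (qGamma q ((real n + \<epsilon>) - real i + 1))) *
        (qGamma q (2 * (real m + \<epsilon>) + 1) *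
        (inverse (qGamma q ((real m + \<epsilon>) - real i + 2)) * inverse (qGamma q ((real m + \<epsilon>) - real i + 1)))) *
        (qGamma q ((real m + \<epsilon>) + (real n + \<epsilon>) - real i - real r + 2) *
         inverse (qGamma q ((real m + \<epsilon>) + (real n + \<epsilon>) - real i + 2))))
      ((0 + - pole_order (2 * int n + 1)) + (pole_order (int n + 2 - int i) + pole_order (int n + 1 - int i)) +
       (- pole_order (2 * int m + 1) + (pole_order (int m + 2 - int i) + pole_order (int m + 1 - int i))) +
       (- pole_order (int m + int n - int r + 2 - int i) + pole_order (int m + int n + 2 - int i)))"
      by (intro vanishing_order_ge_mult vanishing_order_ge_const num den den2)
    moreover have "f i = (\<lambda>\<epsilon>. ((qGamma q (real i))\<^sup>2 * qGamma q (2 * (real n + \<epsilon>) + 1)) *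
        (inverse (qGamma q ((real n + \<epsilon>) - real i + 2)) * inverse (qGamma q ((real n + \<epsilon>) - real i + 1))) *
        (qGamma q (2 * (real m + \<epsilon>) + 1) *
        (inverse (qGamma q ((real m + \<epsilon>) - real i + 2)) * inverse (qGamma q ((real m + \<epsilon>) - real i + 1)))) *
        (qGamma q ((real m + \<epsilon>) + (real n + \<epsilon>) - real i - real r + 2) *
         inverse (qGamma q ((real m + \<epsilon>) + (real n + \<epsilon>) - real i + 2))))"
      by (simp add: fun_eq_iff f_def divide_inverse)
    moreover have "N i = (0 + - pole_order (2 * int n + 1)) + (pole_order (int n + 2 - int i) + pole_order (int n + 1 - int i)) +
       (- pole_order (2 * int m + 1) + (pole_order (int m + 2 - int i) + pole_order (int m + 1 - int i))) +
       (- pole_order (int m + int n - int r + 2 - int i) + pole_order (int m + int n + 2 - int i))"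
      unfolding N_def by (simp add: pole_order_def[of "2 * int _ + 1"])
    ultimately show ?thesis by simp
  qed
  have "vanishing_order_ge (\<lambda>\<epsilon>. \<Prod>i = 1..r. f i \<epsilon>) (\<Sum>i = 1..r. N i)"
    using order_f by (rule vanishing_order_ge_prod)
  then have "vanishing_order_ge (\<lambda>\<epsilon>. rhs_prod q r (real m + \<epsilon>) (real n + \<epsilon>)) (0 + (\<Sum>i = 1..r. N i))"
    unfolding rhs_prod_def f_def by (rule vanishing_order_ge_mult[OF vanishing_order_ge_const])
  moreover have "0 + (\<Sum>i = 1..r. N i) \<ge> 1"
    using total_order_pos[OF assms] by (simp add: N_def)
  ultimately show ?thesis by (rule vanishing_order_ge_tendsto_0)
qed

lemma qGamma_0: "qGamma q 0 = 0"
  using qpoch_inf_split[of 1 1] q0 by (auto simp: qGamma_def)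

text \<open>
  The factor with \<open>i = n + 1\<close> or \<open>i = m + 1\<close> is a division by \<open>\<Gamma>\<^sub>q(0)\<close>, which is 0 by convention.
\<close>
lemma rhs_prod_eq_0:
  assumes "n < r \<or> m < r"
  shows "rhs_prod q r (real m) (real n) = 0"
proof -
  have "\<exists>i\<in>{1..r}. qGamma q (real n - real i + 1) = 0 \<or> qGamma q (real m - real i + 1) = 0"
  proof (cases "n < r")
    case True
    then show ?thesis using qGamma_0 by (intro bexI[of _ "Suc n"]) auto
  next
    case False
    then show ?thesis using qGamma_0 assms by (intro bexI[of _ "Suc m"]) auto
  qed
  then show ?thesis unfolding rhs_prod_def by (auto simp: prod_zero_iff)
qed

end

text \<open>
  If \<open>r \<le> min m n\<close>, then \<open>m + n - i - r + 2 \<ge> 2\<close> for \<open>i \<le> r\<close>.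
\<close>
lemma numerator_pole_imp_less:
  assumes "rhs_numerator_pole r (real m) (real n)"
  shows "n < r \<or> m < r"
proof (rule ccontr)
  assume "\<not> (n < r \<or> m < r)"
  then have nr: "r \<le> n" "r \<le> m" by auto
  have "x \<notin> \<int>\<^sub>\<le>\<^sub>0" if "x > 0" for x :: real
    using that by (auto elim: nonpos_Ints_cases)
  moreover have "x > 0" if "i \<in> {1..r}" "x \<in> {real i, 2 * real n + 1, 2 * real m + 1, real m + real n - real i - real r + 2}" for x i
    using that nr by auto
  ultimately show False using assms unfolding rhs_numerator_pole_def by blast
qed

section \<open>The identity\<close>

theorem proposition6p3:
  fixes q :: real and m n r :: nat
  assumes "0 < q" and "q < 1" and "r \<ge> 1"
  shows "if rhs_numerator_pole r (real m) (real n)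
         then ((\<lambda>\<epsilon>::real. rhs_prod q r (real m + \<epsilon>) (real n + \<epsilon>)) \<longlongrightarrow> lhs_sum q r m n) (at 0)
         else lhs_sum q r m n = rhs_prod q r (real m) (real n)"
proof -
  interpret unit_interval_base q using assms(1,2) by unfold_locales
  show ?thesis
  proof (cases "n < r \<or> m < r")
    case True
    have "lhs_sum q r m n = 0"
      using lhs_sum_vanishes[OF True] .
    then show ?thesis
      using rhs_prod_tendsto_0[OF True] rhs_prod_eq_0[OF True] by simp
  next
    case False
    then have "\<not> rhs_numerator_pole r (real m) (real n)"
      using numerator_pole_imp_less by blast
    moreover have "r \<le> n" "r \<le> m" using False by auto
    ultimately show ?thesis using lhs_sum_eq_rhs_prod by simp
  qed
qed

end
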